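(* There exists a universal constant $C > 0$ such that the following holds. Let $n \geq 1$ be an integer, let $\|\cdot\|$ be a norm on $\mathbb{R}^n$, let $0 < \varepsilon < 1/2$, and let $k \geq 2$ be an integer satisfying $$ n \geq \left(\frac{C}{\varepsilon}\right)^{3(k-1)}. $$ Then there exist a $k$-dimensional linear subspace $E \subseteq \mathbb{R}^n$ and an unconditional norm $|||\cdot|||$ on $E$ such that for all $x \in E$, $$ (1-\varepsilon)\, |||x||| \leq \|x\| \leq (1+\varepsilon)\, |||x|||. $$
   Context: $\mathbb{R}^n$ is equipped with its standard Euclidean inner product. A norm $|||\cdot|||$ on a $k$-dimensional linear subspace $E \subseteq \mathbb{R}^n$ is called unconditional if there exists an orthonormal basis $(u_1,\ldots,u_k)$ of $E$ (with respect to the standard inner product) such that for all $x_1,\ldots,x_k \in \mathbb{R}$ and all signs $\delta_1,\ldots,\delta_k \in \{\pm 1\}$, $$ \Big|\Big|\Big| \sum_{i=1}^k \delta_i x_i u_i \Big|\Big|\Big| = \Big|\Big|\Big| \sum_{i=1}^k x_i u_i \Big|\Big|\Big|. $$ "Universal constant" means that $C$ does not depend on $n$, $k$, $\varepsilon$ or the norm. *)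

theory Defs
  imports "HOL-Analysis.Analysis" "HOL-Analysis.Finite_Function_Topology"
begin

text \<open>
  The constant of the theorem is chosen before the dimension \<open>n\<close>, so \<open>n\<close> has to be a term and not
  the cardinality of an index type as in \<open>real ^ 'n\<close>. All the spaces \<open>\<real>\<^sup>n\<close> are therefore taken
  inside the single real vector space of finitely supported sequences, with coordinates numbered
  from \<open>0\<close>. The built-in \<^const>\<open>norm\<close> of that type is an \<open>\<ell>\<^sub>1\<close> norm and is not used.
\<close>

type_synonym rvec = "nat \<Rightarrow>\<^sub>0 real"

definition Rn :: "nat \<Rightarrow> rvec set" where
  "Rn n = {x. \<forall>i\<ge>n. Poly_Mapping.lookup x i = 0}"

definition inner_Rn :: "nat \<Rightarrow> rvec \<Rightarrow> rvec \<Rightarrow> real" where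
  "inner_Rn n x y = (\<Sum>i<n. Poly_Mapping.lookup x i * Poly_Mapping.lookup y i)"

text \<open>Only the values of \<open>p\<close> on \<open>V\<close> matter.\<close>

definition norm_on :: "'a::real_vector set \<Rightarrow> ('a \<Rightarrow> real) \<Rightarrow> bool" where
  "norm_on V p \<longleftrightarrow>
     (\<forall>x\<in>V. 0 \<le> p x) \<and>
     (\<forall>x\<in>V. p x = 0 \<longleftrightarrow> x = 0) \<and>
     (\<forall>c. \<forall>x\<in>V. p (c *\<^sub>R x) = \<bar>c\<bar> * p x) \<and>
     (\<forall>x\<in>V. \<forall>y\<in>V. p (x + y) \<le> p x + p y)"

definition orthonormal_basis :: "nat \<Rightarrow> rvec set \<Rightarrow> nat \<Rightarrow> (nat \<Rightarrow> rvec) \<Rightarrow> bool" where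
  "orthonormal_basis n E k u \<longleftrightarrow>
     (\<forall>i<k. u i \<in> E) \<and>
     (\<forall>i<k. \<forall>j<k. inner_Rn n (u i) (u j) = (if i = j then 1 else 0)) \<and>
     span (u ` {..<k}) = E"

definition unconditional_norm_on :: "nat \<Rightarrow> rvec set \<Rightarrow> (rvec \<Rightarrow> real) \<Rightarrow> bool" where
  "unconditional_norm_on n E p \<longleftrightarrow>
     norm_on E p \<and>
     (\<exists>u. orthonormal_basis n E (dim E) u \<and>
       (\<forall>x \<delta> :: nat \<Rightarrow> real. (\<forall>i<dim E. \<delta> i \<in> {1, -1}) \<longrightarrow>
         p (\<Sum>i<dim E. (\<delta> i * x i) *\<^sub>R u i) = p (\<Sum>i<dim E. x i *\<^sub>R u i)))"

lemma lookup_scaleR: "Poly_Mapping.lookup (c *\<^sub>R (x::rvec)) i = c * Poly_Mapping.lookup x i"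
proof -
  have "finite {i. c *\<^sub>R Poly_Mapping.lookup x i \<noteq> 0}"
    by (rule finite_subset[OF _ Poly_Mapping.finite_keys[of x]]) (auto simp: in_keys_iff)
  then show ?thesis
    by (simp add: scaleR_poly_mapping_def)
qed

lemma subspace_Rn: "subspace (Rn n)"
  by (auto simp: subspace_def Rn_def lookup_add lookup_scaleR)

lemma dim_Rn: "dim (Rn n) = n"
proof (rule dim_unique)
  let ?e = "\<lambda>i::nat. Poly_Mapping.single i (1::real)"
  have inj: "inj_on ?e A" for A
    by (rule inj_on_inverseI[where g = "\<lambda>v. the_elem (Poly_Mapping.keys v)"]) simp
  show "?e ` {..<n} \<subseteq> Rn n"
    by (auto simp: Rn_def lookup_single when_def)
  have expand: "Poly_Mapping.lookup (\<Sum>i<n. f i *\<^sub>R ?e i) j = (if j < n then f j else 0)" for f j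
    by (simp add: lookup_sum lookup_scaleR lookup_single when_def if_distrib cong: if_cong)
  show "Rn n \<subseteq> span (?e ` {..<n})"
  proof
    fix x assume "x \<in> Rn n"
    then have "x = (\<Sum>i<n. Poly_Mapping.lookup x i *\<^sub>R ?e i)"
      by (intro poly_mapping_eqI) (simp only: expand, auto simp: Rn_def)
    also have "\<dots> \<in> span (?e ` {..<n})"
      by (intro span_sum span_scale span_base) auto
    finally show "x \<in> span (?e ` {..<n})" .
  qed
  show "independent (?e ` {..<n})"
    unfolding independent_explicit_finite_subsets
  proof (intro allI impI ballI)
    fix S u v
    assume S: "S \<subseteq> ?e ` {..<n}" "finite S" and 0: "(\<Sum>v\<in>S. u v *\<^sub>R v) = 0" and v: "v \<in> S"
    obtain j where j: "v = ?e j" using S v by auto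
    have "u w * Poly_Mapping.lookup w j = (if w = v then u v else 0)" if w: "w \<in> S" for w
    proof -
      obtain i where "w = ?e i" using S w by auto
      with j show ?thesis using inj_eq[OF inj[of UNIV], of i j] by (auto simp: lookup_single when_def)
    qed
    then have "Poly_Mapping.lookup (\<Sum>v\<in>S. u v *\<^sub>R v) j = (\<Sum>w\<in>S. if w = v then u v else 0)"
      by (simp add: lookup_sum lookup_scaleR)
    then show "u v = 0"
      using 0 S v by simp
  qed
  show "card (?e ` {..<n}) = n"
    using inj by (simp add: card_image)
qed

end

theory Submission
  imports Defs "HOL-Library.Z2" "HOL-Combinatorics.Permutations" "HOL-Library.Disjoint_Sets"
begin

text \<open>
  Let \<open>v\<^sub>1, \<dots>, v\<^sub>k\<close> be vectors with pairwise disjoint supports and \<open>p v\<^sub>i = 1\<close>. Averaging \<open>p\<close> over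
  all sign changes gives an unconditional norm \<open>q\<close> on their span, and one wants
  \<open>p (\<Sum> \<plusminus> y\<^sub>i v\<^sub>i) \<approx> q y\<close>. On finitely many vectors \<open>y\<close> this can be arranged exactly: the
  components of \<open>p (\<Sum> \<plusminus> y\<^sub>i v\<^sub>i)\<close> along the nontrivial characters of the group of sign changes are
  equivariant functions of the \<open>v\<^sub>i\<close>, so a Borsuk-Ulam theorem for products of spheres provides a
  common zero. The equation belonging to a character is charged to the largest index that the
  character contains, and \<open>v\<^sub>j\<close> ranges over a sphere whose dimension is the number of equations
  charged to \<open>j\<close>; with this bookkeeping the relevant mod 2 Euler number is 1.

  To keep the number of test vectors below \<open>(C/\<epsilon>)\<^sup>k\<close>, without a factor growing like \<open>k\<^sup>k\<close>, the
  coordinates are rescaled by the point \<open>s\<close> of the unit ball of \<open>q\<close> that maximises the product of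
  the coordinates (Lozanovskii). After rescaling the unit ball of \<open>q\<close> lies between the unit cube
  and \<open>k\<close> times the cross-polytope, and the points of \<open>(1/N) \<int>\<^sup>k\<close> in the latter suffice. The point
  \<open>s\<close> is unique, hence a continuous and sign-invariant function of the \<open>v\<^sub>i\<close>, so that the rescaled
  test vectors still give equivariant equations.
\<close>

section \<open>A Borsuk-Ulam theorem for products of spheres\<close>

text \<open>
  The \<open>j\<close>-th sphere modulo antipodes is the cube spanned by the coordinates \<open>r\<close> with \<open>b r = j\<close>, whose
  boundary points are identified with their negatives. The product is triangulated
  by splitting every grid cube into simplices, the vertices of a simplex being ordered along a path
  that starts at a point \<open>z\<close> with even coordinates and changes one coordinate at a time, in the
  order \<open>\<rho>\<close>, to the odd values \<open>w\<close>. Unlike the order by size, this order is invariant under the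
  boundary identifications.
\<close>

declare add_bit_eq_xor [simp del] mult_bit_eq_and [simp del]

text \<open>\<open>\<rho> r\<close> is the time at which coordinate \<open>r\<close> moves, so
  \<open>inv \<rho> l\<close> is the coordinate moved between the vertices \<open>l\<close> and
  \<open>l + 1\<close>. Vertex 0 is \<open>z\<close> and vertex \<open>M\<close> is
  \<open>w\<close>.\<close>

definition vtx :: "(nat \<Rightarrow> int) \<Rightarrow> (nat \<Rightarrow> int) \<Rightarrow> (nat \<Rightarrow> nat) \<Rightarrow> nat \<Rightarrow> nat \<Rightarrow> int" where
  "vtx z w \<rho> l r = (if \<rho> r < l then w r else z r)"

definition grid :: "nat \<Rightarrow> int \<Rightarrow> (nat \<Rightarrow> int) set" where
  "grid M L = {v. (\<forall>r<M. \<bar>v r\<bar> \<le> L) \<and> (\<forall>r\<ge>M. v r = 0)}"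

definition cells :: "nat \<Rightarrow> int \<Rightarrow> ((nat \<Rightarrow> int) \<times> (nat \<Rightarrow> int) \<times> (nat \<Rightarrow> nat)) set" where
  "cells M L = {(z, w, \<rho>). z \<in> grid M L \<and> w \<in> grid M L \<and>
     (\<forall>r<M. even (z r) \<and> \<bar>w r - z r\<bar> = 1) \<and> \<rho> permutes {..<M}}"

text \<open>The antipodal map on the \<open>j\<close>-th sphere, \<open>b r\<close> being the block
  of coordinate \<open>r\<close>. At boundary points of the \<open>j\<close>-th cube it is the
  gluing map.\<close>

definition flip :: "(nat \<Rightarrow> nat) \<Rightarrow> nat \<Rightarrow> (nat \<Rightarrow> 'a::ab_group_add) \<Rightarrow> nat \<Rightarrow> 'a" where
  "flip b j v r = (if b r = j then - v r else v r)"

lemma flip_flip [simp]: "flip b j (flip b j v) = v"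
  by (auto simp: flip_def)

lemma flip_grid: "v \<in> grid M L \<Longrightarrow> flip b j v \<in> grid M L"
  by (auto simp: grid_def flip_def)

lemma vtx_grid: "(z, w, \<rho>) \<in> cells M L \<Longrightarrow> vtx z w \<rho> l \<in> grid M L"
  by (auto simp: cells_def grid_def vtx_def)

lemma vtx_flip: "vtx (flip b j z) (flip b j w) \<rho> l = flip b j (vtx z w \<rho> l)"
  by (auto simp: vtx_def flip_def)

lemma finite_cells: "finite (cells M L)"
proof -
  have "finite (grid M L)"
    by (rule finite_subset[OF _ finite_set_of_finite_funs[of "{..<M}" "{-L..L}" 0]])
       (auto simp: grid_def abs_le_iff)
  moreover have "cells M L \<subseteq> grid M L \<times> grid M L \<times> {\<rho>. \<rho> permutes {..<M}}"
    by (auto simp: cells_def)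
  moreover have "finite {\<rho>. \<rho> permutes {..<M}}"
    by (rule finite_permutations) simp
  ultimately show ?thesis
    by (metis finite_subset finite_cartesian_product)
qed

text \<open>Reflecting \<open>z\<close> in \<open>w\<close> along the first coordinate to move gives
  the other cell with the same vertices 1 to \<open>M\<close>, so terms that ignore vertex 0 cancel
  mod 2.\<close>

lemma sum_cells_0:
  fixes \<phi> :: "(nat \<Rightarrow> nat \<Rightarrow> int) \<Rightarrow> bit"
  assumes L: "even L" and M: "0 < M"
    and dep: "\<And>V V'. (\<And>l. 0 < l \<Longrightarrow> l \<le> M \<Longrightarrow> V l = V' l) \<Longrightarrow> \<phi> V = \<phi> V'"
  shows "(\<Sum>(z, w, \<rho>)\<in>cells M L. \<phi> (vtx z w \<rho>)) = 0"
proof (rule sum_involution_eq_0[where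
      h = "\<lambda>(z, w, \<rho>). (z(inv \<rho> 0 := 2 * w (inv \<rho> 0) - z (inv \<rho> 0)), w, \<rho>)"], goal_cases)
  case (1 x)
  obtain z w \<rho> where x: "x = (z, w, \<rho>)" by (cases x)
  have p: "\<rho> permutes {..<M}" using 1 x by (auto simp: cells_def)
  have "\<phi> (vtx (z(inv \<rho> 0 := 2 * w (inv \<rho> 0) - z (inv \<rho> 0))) w \<rho>) = \<phi> (vtx z w \<rho>)"
  proof (rule dep, rule ext)
    fix l r :: nat assume "0 < l"
    then show "vtx (z(inv \<rho> 0 := 2 * w (inv \<rho> 0) - z (inv \<rho> 0))) w \<rho> l r = vtx z w \<rho> l r"
      using permutes_inverses(1)[OF p] by (auto simp: vtx_def)
  qed
  then show ?case by (simp add: x)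
next
  case (2 x)
  obtain z w \<rho> where x: "x = (z, w, \<rho>)" by (cases x)
  define r where "r = inv \<rho> 0"
  have p: "\<rho> permutes {..<M}" using 2 x by (auto simp: cells_def)
  have c: "even (z r')" "\<bar>w r' - z r'\<bar> = 1" "\<bar>w r'\<bar> \<le> L" if "r' < M" for r'
    using 2 x that by (auto simp: cells_def grid_def)
  have r: "r < M"
    using permutes_in_image[OF permutes_inv[OF p], of 0] M by (simp add: r_def)
  \<comment> \<open>As \<open>L\<close> is even and \<open>w r\<close> odd,
    \<open>\<bar>w r\<bar> < L\<close>, so the reflected value stays in the grid.\<close>
  have "odd (w r)" using c[OF r] by presburger
  then have "\<bar>2 * w r - z r\<bar> \<le> L" using c[OF r] L by presburger
  then show ?case
    using 2 r c(1,2)[OF r] by (auto simp: x cells_def grid_def simp flip: r_def)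
next
  case (3 x)
  then show ?case by (auto simp: cells_def)
next
  case (4 x)
  obtain z w \<rho> where x: "x = (z, w, \<rho>)" by (cases x)
  have p: "\<rho> permutes {..<M}" using 4 x by (auto simp: cells_def)
  have r: "inv \<rho> 0 < M"
    using permutes_in_image[OF permutes_inv[OF p], of 0] M by simp
  then have "\<bar>w (inv \<rho> 0) - z (inv \<rho> 0)\<bar> = 1"
    using 4 x by (auto simp: cells_def)
  then have "2 * w (inv \<rho> 0) - z (inv \<rho> 0) \<noteq> z (inv \<rho> 0)" by auto
  then show ?case by (auto simp: x fun_upd_idem_iff)
qed

text \<open>Exchanging the moves made at the times \<open>i - 1\<close> and \<open>i\<close> alters
  vertex \<open>i\<close> only, and pairs the cells.\<close>

lemma sum_cells_interior:
  fixes \<phi> :: "(nat \<Rightarrow> nat \<Rightarrow> int) \<Rightarrow> bit"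
  assumes i: "0 < i" "i < M"
    and dep: "\<And>V V'. (\<And>l. l \<noteq> i \<Longrightarrow> l \<le> M \<Longrightarrow> V l = V' l) \<Longrightarrow> \<phi> V = \<phi> V'"
  shows "(\<Sum>(z, w, \<rho>)\<in>cells M L. \<phi> (vtx z w \<rho>)) = 0"
proof (rule sum_involution_eq_0[where
      h = "\<lambda>(z, w, \<rho>). (z, w, Transposition.transpose (i - 1) i \<circ> \<rho>)"], goal_cases)
  case (1 x)
  obtain z w \<rho> where x: "x = (z, w, \<rho>)" by (cases x)
  have "\<phi> (vtx z w (Transposition.transpose (i - 1) i \<circ> \<rho>)) = \<phi> (vtx z w \<rho>)"
  proof (rule dep, rule ext)
    fix l r :: nat assume "l \<noteq> i"
    then show "vtx z w (Transposition.transpose (i - 1) i \<circ> \<rho>) l r = vtx z w \<rho> l r"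
      using i by (auto simp: vtx_def Transposition.transpose_def)
  qed
  then show ?case by (simp add: x)
next
  case (2 x)
  obtain z w \<rho> where x: "x = (z, w, \<rho>)" by (cases x)
  have "Transposition.transpose (i - 1) i permutes {..<M}" using i by (intro permutes_swap_id) auto
  then show ?case using 2 by (auto simp: x cells_def intro: permutes_compose)
next
  case (3 x)
  show ?case by (cases x) (auto simp: fun_eq_iff)
next
  case (4 x)
  obtain z w \<rho> where x: "x = (z, w, \<rho>)" by (cases x)
  have p: "\<rho> permutes {..<M}" using 4 x by (auto simp: cells_def)
  have "(Transposition.transpose (i - 1) i \<circ> \<rho>) (inv \<rho> i) \<noteq> \<rho> (inv \<rho> i)"
    using i by (simp add: permutes_inverses(1)[OF p])
  then show ?case unfolding x by (metis case_prod_conv prod.inject)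
qed

text \<open>The last coordinate to move has the value \<open>z r\<close> at all vertices before the
  last. If \<open>\<bar>z r\<bar> < L\<close>, reflect \<open>w\<close> in \<open>z\<close> there;
  otherwise the facet lies on the boundary of the cube and is paired with its glued copy, which is
  why \<open>\<phi>\<close> has to be invariant under flips of such facets.\<close>

lemma sum_cells_last:
  fixes \<phi> :: "(nat \<Rightarrow> nat \<Rightarrow> int) \<Rightarrow> bit"
  assumes M: "0 < M" and L: "0 < L"
    and dep: "\<And>V V'. (\<And>l. l < M \<Longrightarrow> V l = V' l) \<Longrightarrow> \<phi> V = \<phi> V'"
    and bdry: "\<And>V r. (\<And>l. l < M \<Longrightarrow> V l \<in> grid M L \<and> \<bar>V l r\<bar> = L) \<Longrightarrow> r < M \<Longrightarrow>
       \<phi> (\<lambda>l. flip b (b r) (V l)) = \<phi> V"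
  shows "(\<Sum>(z, w, \<rho>)\<in>cells M L. \<phi> (vtx z w \<rho>)) = 0"
proof (rule sum_involution_eq_0[where
      h = "\<lambda>(z, w, \<rho>). let r = inv \<rho> (M - Suc 0) in
        if \<bar>z r\<bar> < L then (z, w(r := 2 * z r - w r), \<rho>)
        else (flip b (b r) z, flip b (b r) w, \<rho>)"], goal_cases)
  case (1 x)
  obtain z w \<rho> where x: "x = (z, w, \<rho>)" by (cases x)
  define r where "r = inv \<rho> (M - Suc 0)"
  have p: "\<rho> permutes {..<M}" using 1 x by (auto simp: cells_def)
  have zL: "\<bar>z r'\<bar> \<le> L" if "r' < M" for r'
    using 1 x that by (auto simp: cells_def grid_def)
  have \<rho>r: "\<rho> r = M - Suc 0" using permutes_inverses(1)[OF p] by (simp add: r_def)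
  have r: "r < M"
    using permutes_in_image[OF permutes_inv[OF p], of "M - Suc 0"] M by (simp add: r_def)
  show ?case
  proof (cases "\<bar>z r\<bar> < L")
    case True
    have "\<phi> (vtx z (w(r := 2 * z r - w r)) \<rho>) = \<phi> (vtx z w \<rho>)"
      by (rule dep, rule ext) (auto simp: vtx_def \<rho>r)
    then show ?thesis using True by (simp add: x Let_def flip: r_def)
  next
    case False
    have "\<phi> (vtx (flip b (b r) z) (flip b (b r) w) \<rho>) = \<phi> (\<lambda>l. flip b (b r) (vtx z w \<rho> l))"
      by (rule dep) (simp add: vtx_flip)
    also have "\<dots> = \<phi> (vtx z w \<rho>)"
      using False zL[OF r] vtx_grid[of z w \<rho> M L] 1 r
      by (intro bdry) (auto simp: x vtx_def \<rho>r)
    finally show ?thesis using False by (simp add: x Let_def flip: r_def)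
  qed
next
  case (2 x)
  obtain z w \<rho> where x: "x = (z, w, \<rho>)" by (cases x)
  define r where "r = inv \<rho> (M - Suc 0)"
  have p: "\<rho> permutes {..<M}" using 2 x by (auto simp: cells_def)
  have c: "even (z r')" "\<bar>w r' - z r'\<bar> = 1" "\<bar>z r'\<bar> \<le> L" if "r' < M" for r'
    using 2 x that by (auto simp: cells_def grid_def)
  have r: "r < M"
    using permutes_in_image[OF permutes_inv[OF p], of "M - Suc 0"] M by (simp add: r_def)
  show ?case
  proof (cases "\<bar>z r\<bar> < L")
    case True
    then have "\<bar>2 * z r - w r\<bar> \<le> L" using c[OF r] by linarith
    then show ?thesis using True 2 r c(2)[OF r]
      by (auto simp: x Let_def cells_def grid_def simp flip: r_def)
  next
    case False
    then have "(flip b (b r) z, flip b (b r) w, \<rho>) \<in> cells M L"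
      using 2 unfolding x cells_def
      by (auto intro!: flip_grid) (auto simp: flip_def)
    then show ?thesis using False by (simp add: x Let_def flip: r_def)
  qed
next
  case (3 x)
  obtain z w \<rho> where x: "x = (z, w, \<rho>)" by (cases x)
  define r where "r = inv \<rho> (M - Suc 0)"
  have "\<bar>flip b j z r\<bar> = \<bar>z r\<bar>" for j by (simp add: flip_def)
  then show ?case by (auto simp: x Let_def simp flip: r_def)
next
  case (4 x)
  obtain z w \<rho> where x: "x = (z, w, \<rho>)" by (cases x)
  define r where "r = inv \<rho> (M - Suc 0)"
  have p: "\<rho> permutes {..<M}" using 4 x by (auto simp: cells_def)
  have c: "\<bar>w r' - z r'\<bar> = 1" if "r' < M" for r'
    using 4 x that by (auto simp: cells_def grid_def)
  have r: "r < M"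
    using permutes_in_image[OF permutes_inv[OF p], of "M - Suc 0"] M by (simp add: r_def)
  have a: "w(r := 2 * z r - w r) \<noteq> w" using c[OF r] by (auto simp: fun_upd_idem_iff)
  have "flip b (b r) z r \<noteq> z r" if "\<not> \<bar>z r\<bar> < L" using that L by (auto simp: flip_def)
  then have "flip b (b r) z \<noteq> z" if "\<not> \<bar>z r\<bar> < L" using that by metis
  with a show ?case by (auto simp: x Let_def simp flip: r_def)
qed

section \<open>Mod 2 cochains and the degree\<close>

definition cellsum :: "nat \<Rightarrow> int \<Rightarrow> ((nat \<Rightarrow> nat \<Rightarrow> int) \<Rightarrow> bit) \<Rightarrow> bit" where
  "cellsum M L \<phi> = (\<Sum>(z, w, \<rho>)\<in>cells M L. \<phi> (vtx z w \<rho>))"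

lemma cellsum_add: "cellsum M L (\<lambda>V. \<phi> V + \<psi> V) = cellsum M L \<phi> + cellsum M L \<psi>"
  unfolding cellsum_def by (subst sum.distrib[symmetric]) (auto intro!: sum.cong)

text \<open>The coboundary of the 0-cochain \<open>s e\<close> on the edge from vertex
  \<open>m\<close> to vertex \<open>m + 1\<close>.\<close>

definition step :: "(nat \<Rightarrow> (nat \<Rightarrow> int) \<Rightarrow> bit) \<Rightarrow> (nat \<Rightarrow> nat \<Rightarrow> int) \<Rightarrow> nat \<Rightarrow> nat \<Rightarrow> bit" where
  "step s V e m = s e (V m) + s e (V (Suc m))"

lemma bit_add_cancel_mid: "((a::bit) + c) + (c + d) = a + d"
  by (cases a; cases c; cases d) simp_all

text \<open>Moving the factors before \<open>e0\<close> one edge up, one at a time, changes the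
  product by a term that omits an interior vertex, so the sum stays the same. In the end vertex 0
  occurs nowhere, and \<open>sum_cells_0\<close> applies.\<close>

lemma cellsum_upper:
  assumes L: "even L" and e0: "e0 < M"
  shows "cellsum M L (\<lambda>V. (\<Prod>e<e0. step s V e e) * h (V (Suc e0)) *
    (\<Prod>e\<in>{Suc e0..<M}. step s V e e)) = 0"
proof -
  \<comment> \<open>\<open>F i + F (i + 1)\<close> does not depend on the vertex \<open>i + 1\<close>: it is the term of the coboundary omitting it.\<close>
  define Q where "Q V = h (V (Suc e0)) * (\<Prod>e\<in>{Suc e0..<M}. step s V e e)" for V
  define F where "F i V = (\<Prod>e<i. step s V e e) * (\<Prod>e\<in>{i..<e0}. step s V e (Suc e)) * Q V" for i V
  have Q: "Q V = Q V'" if "\<And>l. e0 < l \<Longrightarrow> l \<le> M \<Longrightarrow> V l = V' l" for V V'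
    unfolding Q_def step_def using that e0
    by (intro arg_cong2[where f = "(*)"] prod.cong) auto
  have "cellsum M L (F i) = 0" if "i \<le> e0" for i
    using that
  proof (induction i)
    case 0
    show ?case unfolding cellsum_def
    proof (rule sum_cells_0[OF L])
      fix V V' :: "nat \<Rightarrow> nat \<Rightarrow> int"
      assume eq: "\<And>l. 0 < l \<Longrightarrow> l \<le> M \<Longrightarrow> V l = V' l"
      show "F 0 V = F 0 V'"
        unfolding F_def using e0
        by (intro arg_cong2[where f = "(*)"] prod.cong Q) (auto simp: step_def eq)
    qed (use e0 in auto)
  next
    case (Suc i)
    have i: "i < e0" using Suc by simp
    have "cellsum M L (\<lambda>V. F i V + F (Suc i) V) = 0"
      unfolding cellsum_def
    proof (rule sum_cells_interior[of "Suc i"])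
      fix V V' :: "nat \<Rightarrow> nat \<Rightarrow> int"
      assume eq: "\<And>l. l \<noteq> Suc i \<Longrightarrow> l \<le> M \<Longrightarrow> V l = V' l"
      have F: "F i V + F (Suc i) V = (\<Prod>e<i. step s V e e) * (s i (V i) + s i (V (Suc (Suc i)))) *
          (\<Prod>e\<in>{Suc i..<e0}. step s V e (Suc e)) * Q V" for V
      proof -
        have "F i V + F (Suc i) V = (\<Prod>e<i. step s V e e) * (step s V i i + step s V i (Suc i)) *
          (\<Prod>e\<in>{Suc i..<e0}. step s V e (Suc e)) * Q V"
          unfolding F_def prod.atLeast_Suc_lessThan[OF i] prod.lessThan_Suc
          by (simp only: algebra_simps)
        then show ?thesis unfolding step_def bit_add_cancel_mid .
      qed
      show "F i V + F (Suc i) V = F i V' + F (Suc i) V'"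
        unfolding F using e0 i
        by (intro arg_cong2[where f = "(*)"] arg_cong2[where f = "(+)"] prod.cong Q)
           (auto simp: step_def eq)
    qed (use i e0 in auto)
    then show ?case using Suc unfolding cellsum_add by simp
  qed
  from this[of e0] show ?thesis by (simp add: F_def[abs_def] Q_def mult.assoc)
qed

text \<open>The mirror image of \<open>cellsum_upper\<close>: the factors after \<open>e0\<close>
  move one edge down until vertex \<open>M\<close> is free. Facets opposite that vertex may lie on
  the boundary of the cube, which is where equivariance enters.\<close>

lemma cellsum_lower:
  assumes L: "0 < L" and e0: "e0 < M"
    and s: "\<And>e v r. e < M \<Longrightarrow> v \<in> grid M L \<Longrightarrow> r < M \<Longrightarrow> \<bar>v r\<bar> = L \<Longrightarrow>
      s e (flip b (b r) v) = s e v + of_bool (b r \<in> \<gamma> e)"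
    and h: "\<And>v r. v \<in> grid M L \<Longrightarrow> r < M \<Longrightarrow> \<bar>v r\<bar> = L \<Longrightarrow> h (flip b (b r) v) = h v"
  shows "cellsum M L (\<lambda>V. (\<Prod>e<e0. step s V e e) * h (V e0) *
    (\<Prod>e\<in>{Suc e0..<M}. step s V e e)) = 0"
proof -
  define Q where "Q V = (\<Prod>e<e0. step s V e e) * h (V e0)" for V
  define F where "F i V = Q V * (\<Prod>e\<in>{Suc e0..<i}. step s V e (e - 1)) * (\<Prod>e\<in>{i..<M}. step s V e e)" for i V
  have Q: "Q V = Q V'" if "\<And>l. l \<le> e0 \<Longrightarrow> V l = V' l" for V V'
    unfolding Q_def step_def using that e0
    by (intro arg_cong2[where f = "(*)"] prod.cong) auto
  have "cellsum M L (F (Suc e0)) = 0"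
  proof (rule inc_induct[of "Suc e0" M])
    show "cellsum M L (F M) = 0"
      unfolding cellsum_def
    proof (rule sum_cells_last[where b = b])
      fix V V' :: "nat \<Rightarrow> nat \<Rightarrow> int"
      assume eq: "\<And>l. l < M \<Longrightarrow> V l = V' l"
      show "F M V = F M V'"
        unfolding F_def using e0
        by (intro arg_cong2[where f = "(*)"] prod.cong Q) (auto simp: step_def eq)
    next
      fix V :: "nat \<Rightarrow> nat \<Rightarrow> int" and r
      assume V: "\<And>l. l < M \<Longrightarrow> V l \<in> grid M L \<and> \<bar>V l r\<bar> = L" and r: "r < M"
      let ?V = "\<lambda>l. flip b (b r) (V l)"
      \<comment> \<open>A flip changes \<open>s e\<close> by the same bit at both ends of an edge,
        so the coboundary is invariant.\<close>
      have "step s ?V e m = step s V e m" if "Suc m < M" "e < M" for e m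
        unfolding step_def using that V r
        by (simp add: s)
      then show "F M ?V = F M V"
        unfolding F_def Q_def using e0 V r
        by (intro arg_cong2[where f = "(*)"] prod.cong) (auto simp: h)
    qed (use e0 L in auto)
  next
    fix i assume i: "Suc e0 \<le> i" "i < M" and IH: "cellsum M L (F (Suc i)) = 0"
    have "cellsum M L (\<lambda>V. F i V + F (Suc i) V) = 0"
      unfolding cellsum_def
    proof (rule sum_cells_interior[of i])
      fix V V' :: "nat \<Rightarrow> nat \<Rightarrow> int"
      assume eq: "\<And>l. l \<noteq> i \<Longrightarrow> l \<le> M \<Longrightarrow> V l = V' l"
      have F: "F i V + F (Suc i) V = Q V * (\<Prod>e\<in>{Suc e0..<i}. step s V e (e - 1)) *
          (s i (V (i - 1)) + s i (V (Suc i))) * (\<Prod>e\<in>{Suc i..<M}. step s V e e)" for V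
      proof -
        have "F i V + F (Suc i) V = Q V * (\<Prod>e\<in>{Suc e0..<i}. step s V e (e - 1)) *
          (step s V i (i - 1) + step s V i i) * (\<Prod>e\<in>{Suc i..<M}. step s V e e)"
          unfolding F_def prod.atLeast_Suc_lessThan[OF i(2)] prod.atLeastLessThan_Suc[OF i(1)]
          by (simp only: algebra_simps)
        then show ?thesis using i by (simp add: step_def bit_add_cancel_mid)
      qed
      show "F i V + F (Suc i) V = F i V' + F (Suc i) V'"
        unfolding F using e0 i
        by (intro arg_cong2[where f = "(*)"] arg_cong2[where f = "(+)"] prod.cong Q)
           (auto simp: step_def eq)
    qed (use i e0 in auto)
    then show "cellsum M L (F i) = 0" using IH unfolding cellsum_add by simp
  qed (use e0 in auto)
  then show ?thesis by (simp add: F_def[abs_def] Q_def)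
qed

text \<open>
  The cup product of the cocycles \<open>\<delta>(s e)\<close>, evaluated on the fundamental class. Replacing one
  \<open>s e\<close> by \<open>s e + h\<close> with \<open>h\<close> invariant under the identifications adds a coboundary.
\<close>
definition degree2 :: "nat \<Rightarrow> int \<Rightarrow> (nat \<Rightarrow> (nat \<Rightarrow> int) \<Rightarrow> bit) \<Rightarrow> bit" where
  "degree2 M L s = cellsum M L (\<lambda>V. \<Prod>e<M. step s V e e)"

text \<open>\<open>\<gamma> e\<close> is the set of blocks in which \<open>s e\<close> is odd, so
  the coboundary of \<open>s e\<close> represents the sum of the antipodal classes of these
  blocks.\<close>

definition block_odd where
  "block_odd M L b \<gamma> s \<longleftrightarrow> (\<forall>e<M. \<forall>v\<in>grid M L. \<forall>r<M. \<bar>v r\<bar> = L \<longrightarrow>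
      s e (flip b (b r) v) = s e v + (of_bool (b r \<in> \<gamma> e) :: bit))"

lemma degree2_update:
  assumes L: "even L" "0 < L" and e0: "e0 < M"
    and s: "block_odd M L b \<gamma> s" and s': "block_odd M L b \<gamma> (s(e0 := g))"
  shows "degree2 M L (s(e0 := g)) = degree2 M L s"
proof -
  define h where "h v = s e0 v + g v" for v
  have sb: "s e (flip b (b r) v) = s e v + of_bool (b r \<in> \<gamma> e)"
    if "e < M" "v \<in> grid M L" "r < M" "\<bar>v r\<bar> = L" for e v r
    using s that unfolding block_odd_def by blast
  have gb: "g (flip b (b r) v) = g v + of_bool (b r \<in> \<gamma> e0)"
    if "v \<in> grid M L" "r < M" "\<bar>v r\<bar> = L" for v r
    using s' that e0 unfolding block_odd_def by (metis fun_upd_same)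
  have hb: "h (flip b (b r) v) = h v" if "v \<in> grid M L" "r < M" "\<bar>v r\<bar> = L" for v r
    using sb[OF e0 that] gb[OF that] by (simp add: h_def)
  define A B where "A V = (\<Prod>e<e0. step s V e e)" and "B V = (\<Prod>e\<in>{Suc e0..<M}. step s V e e)" for V
  have split: "(\<Prod>e<M. f e) = (\<Prod>e<e0. f e) * f e0 * (\<Prod>e\<in>{Suc e0..<M}. f e)" for f :: "nat \<Rightarrow> bit"
  proof -
    have "{..<M} = {..<e0} \<union> {e0..<M}" using e0 by auto
    then have "(\<Prod>e<M. f e) = (\<Prod>e<e0. f e) * (\<Prod>e\<in>{e0..<M}. f e)"
      by (simp add: prod.union_disjoint ivl_disj_int_one)
    then show ?thesis by (simp add: prod.atLeast_Suc_lessThan[OF e0] mult.assoc)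
  qed
  \<comment> \<open>The difference has the coboundary of the invariant \<open>h\<close> in place
    \<open>e0\<close>; its two ends are treated by \<open>cellsum_lower\<close> and
    \<open>cellsum_upper\<close>.\<close>
  have "degree2 M L (s(e0 := g)) + degree2 M L s =
    cellsum M L (\<lambda>V. A V * h (V e0) * B V + A V * h (V (Suc e0)) * B V)"
    unfolding degree2_def cellsum_add[symmetric]
  proof (rule arg_cong[where f = "cellsum M L"], rule ext)
    fix V
    have "(\<Prod>e<M. step (s(e0 := g)) V e e) = A V * (g (V e0) + g (V (Suc e0))) * B V"
      unfolding split[of "\<lambda>e. step (s(e0 := g)) V e e"] A_def B_def
      by (intro arg_cong2[where f = "(*)"] prod.cong) (auto simp: step_def)
    moreover have "(\<Prod>e<M. step s V e e) = A V * (s e0 (V e0) + s e0 (V (Suc e0))) * B V"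
      unfolding split[of "\<lambda>e. step s V e e"] A_def B_def by (simp add: step_def)
    ultimately show "(\<Prod>e<M. step (s(e0 := g)) V e e) + (\<Prod>e<M. step s V e e) =
       A V * h (V e0) * B V + A V * h (V (Suc e0)) * B V"
      by (simp add: h_def algebra_simps)
  qed
  also have "\<dots> = 0"
  proof -
    have "cellsum M L (\<lambda>V. A V * h (V e0) * B V) = 0"
      unfolding A_def B_def
      by (rule cellsum_lower[where b = b and \<gamma> = \<gamma>]) (use L e0 sb hb in blast)+
    moreover have "cellsum M L (\<lambda>V. A V * h (V (Suc e0)) * B V) = 0"
      unfolding A_def B_def by (rule cellsum_upper[OF L(1) e0])
    ultimately show ?thesis unfolding cellsum_add by simp
  qed
  finally show ?thesis
    by (cases "degree2 M L (s(e0 := g))"; cases "degree2 M L s") simp_all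
qed

text \<open>The \<open>s e\<close> are replaced one by one by the \<open>s' e\<close>. Thus the
  degree depends on the parity pattern alone and may be computed in a model.\<close>

lemma degree2_cong:
  assumes L: "even L" "0 < L"
    and s: "block_odd M L b \<gamma> s" and s': "block_odd M L b \<gamma> s'"
  shows "degree2 M L s = degree2 M L s'"
proof -
  define t where "t i e = (if e < i then s' e else s e)" for i e
  have t: "block_odd M L b \<gamma> (t i)" for i
    using s s' by (auto simp: block_odd_def t_def)
  have "degree2 M L (t i) = degree2 M L s" if "i \<le> M" for i
    using that
  proof (induction i)
    case 0
    then show ?case by (simp add: t_def)
  next
    case (Suc i)
    have "t (Suc i) = (t i)(i := s' i)"
      by (auto simp: t_def fun_eq_iff)
    then show ?case
      using degree2_update[OF L, of i M b \<gamma> "t i" "s' i"] t[of i] t[of "Suc i"] Suc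
      by (metis Suc_le_lessD Suc_leD)
  qed
  from this[of M] have "degree2 M L s = degree2 M L (t M)" by simp
  also have "\<dots> = degree2 M L s'"
    unfolding degree2_def
    by (intro arg_cong[where f = "cellsum M L"] ext prod.cong) (auto simp: t_def step_def)
  finally show ?thesis .
qed

section \<open>The degree of the model system\<close>

text \<open>
  The model system, in which the \<open>j\<close>-th antipodal class is represented by the sign of the last
  nonzero coordinate of block \<open>j\<close> and exactly one cell contributes to the degree.
\<close>
definition top_sign :: "nat \<Rightarrow> (nat \<Rightarrow> nat) \<Rightarrow> nat \<Rightarrow> (nat \<Rightarrow> int) \<Rightarrow> bit" where
  "top_sign M b j v = of_bool (\<exists>r<M. b r = j \<and> v r > 0 \<and> (\<forall>r'<M. r < r' \<longrightarrow> b r' = j \<longrightarrow> v r' = 0))"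

lemma top_sign_upd_other: "b r \<noteq> j \<Longrightarrow> top_sign M b j (v(r := c)) = top_sign M b j v"
  unfolding top_sign_def by (intro arg_cong[where f = of_bool] ex_cong) (auto simp: fun_upd_def)

lemma top_sign_at_top:
  assumes "r < M" "v r \<noteq> 0" "\<And>r'. r < r' \<Longrightarrow> r' < M \<Longrightarrow> b r' = b r \<Longrightarrow> v r' = 0"
  shows "top_sign M b (b r) v = of_bool (v r > 0)"
proof -
  have "(\<exists>q<M. b q = b r \<and> v q > 0 \<and> (\<forall>r'<M. q < r' \<longrightarrow> b r' = b r \<longrightarrow> v r' = 0)) \<longleftrightarrow> v r > 0"
    using assms by (metis less_irrefl not_less_iff_gr_or_eq)
  then show ?thesis by (simp add: top_sign_def)
qed

lemma obtain_top:
  fixes r0 M :: nat and v :: "nat \<Rightarrow> int"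
  assumes "r0 < M" "v r0 \<noteq> 0" "b r0 = j"
  obtains r where "r < M" "r0 \<le> r" "v r \<noteq> 0" "b r = j"
    "\<And>r'. r < r' \<Longrightarrow> r' < M \<Longrightarrow> b r' = j \<Longrightarrow> v r' = 0"
proof -
  define A where "A = {r. r < M \<and> b r = j \<and> v r \<noteq> 0}"
  have fin: "finite A" unfolding A_def by (rule finite_subset[of _ "{..<M}"]) auto
  have r0: "r0 \<in> A" using assms by (simp add: A_def)
  define m where "m = Max A"
  have "m \<in> A" unfolding m_def using r0 by (intro Max_in fin) auto
  then have m: "m < M" "b m = j" "v m \<noteq> 0" by (auto simp: A_def)
  show ?thesis
  proof (rule that[of m])
    show "r0 \<le> m" unfolding m_def by (rule Max_ge[OF fin r0])
    fix r' assume r': "m < r'" "r' < M" "b r' = j"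
    show "v r' = 0"
    proof (rule ccontr)
      assume "v r' \<noteq> 0"
      then have "r' \<in> A" using r' by (simp add: A_def)
      then show False using Max_ge[OF fin] r'(1) unfolding m_def by (meson not_less)
    qed
  qed (use m in auto)
qed

lemma top_sign_flip_same:
  assumes "r0 < M" "v r0 \<noteq> 0"
  shows "top_sign M b (b r0) (flip b (b r0) v) = top_sign M b (b r0) v + 1"
proof -
  obtain r where r: "r < M" "v r \<noteq> 0" "b r = b r0"
    "\<And>r'. r < r' \<Longrightarrow> r' < M \<Longrightarrow> b r' = b r0 \<Longrightarrow> v r' = 0"
    using obtain_top[of r0 M v b "b r0"] assms by metis
  have "top_sign M b (b r) (flip b (b r0) v) = of_bool (flip b (b r0) v r > 0)"
    using r by (intro top_sign_at_top) (auto simp: flip_def)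
  moreover have "top_sign M b (b r) v = of_bool (v r > 0)"
    using r by (intro top_sign_at_top) auto
  ultimately show ?thesis
    using r(2,3) by (auto simp: flip_def of_bool_def)
qed

lemma top_sign_flip_other:
  "j' \<noteq> j \<Longrightarrow> top_sign M b j (flip b j' v) = top_sign M b j v"
  unfolding top_sign_def by (intro arg_cong[where f = of_bool] ex_cong) (auto simp: flip_def)

text \<open>If some coordinate of the block from \<open>r\<close> upwards is nonzero, the topmost
  such one decides the sign before and after the move: above \<open>r\<close> it is untouched, and
  at \<open>r\<close> it is even, hence at least 2 in absolute value, too large to change sign by a
  move of 1.\<close>

lemma top_sign_change:
  assumes r: "r < M" and v: "even (v r)" "\<bar>c - v r\<bar> = 1"
    and ne: "top_sign M b (b r) (v(r := c)) \<noteq> top_sign M b (b r) v"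
  shows "v r = 0 \<and> (\<forall>r'<M. r < r' \<longrightarrow> b r' = b r \<longrightarrow> v r' = 0)"
proof (rule ccontr)
  assume neg: "\<not> ?thesis"
  have c: "c \<noteq> 0" using v by presburger
  obtain r0 where r0: "r0 < M" "v r0 \<noteq> 0" "b r0 = b r" "r \<le> r0"
    using neg r by (metis order.refl order.strict_implies_order)
  obtain q where q: "q < M" "r0 \<le> q" "v q \<noteq> 0" "b q = b r"
    "\<And>r'. q < r' \<Longrightarrow> r' < M \<Longrightarrow> b r' = b r \<Longrightarrow> v r' = 0"
    using obtain_top[of r0 M v b "b r"] r0 by metis
  have "top_sign M b (b q) v = of_bool (v q > 0)"
    using q by (intro top_sign_at_top) auto
  moreover have "top_sign M b (b q) (v(r := c)) = of_bool ((v(r := c)) q > 0)"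
    using q r0 c by (intro top_sign_at_top) auto
  moreover have "(v(r := c)) q > 0 \<longleftrightarrow> v q > 0"
  proof (cases "q = r")
    case True
    then have "\<bar>v r\<bar> \<ge> 2" using q v(1) by presburger
    then show ?thesis using v(2) True by auto
  qed simp
  ultimately show False using ne q(4) by simp
qed

definition model :: "nat \<Rightarrow> (nat \<Rightarrow> nat) \<Rightarrow> (nat \<Rightarrow> nat set) \<Rightarrow> nat \<Rightarrow> (nat \<Rightarrow> int) \<Rightarrow> bit" where
  "model M b \<gamma> e v = (\<Sum>j\<in>\<gamma> e. top_sign M b j v)"

lemma block_odd_model:
  assumes "0 < L" and fin: "\<And>e. e < M \<Longrightarrow> finite (\<gamma> e)"
  shows "block_odd M L b \<gamma> (model M b \<gamma>)"
  unfolding block_odd_def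
proof (intro allI impI ballI)
  fix e v r assume e: "e < M" and v: "v \<in> grid M L" and r: "r < M" "\<bar>v r\<bar> = L"
  have "v r \<noteq> 0" using r assms by auto
  then have "top_sign M b j (flip b (b r) v) = top_sign M b j v + of_bool (j = b r)" for j
    using top_sign_flip_same[of r M v b] top_sign_flip_other[of "b r" j M b v] r by (cases "j = b r") auto
  then show "model M b \<gamma> e (flip b (b r) v) = model M b \<gamma> e v + of_bool (b r \<in> \<gamma> e)"
    using fin[OF e] by (simp add: model_def sum.distrib of_bool_def)
qed

lemma vtx_Suc:
  assumes "\<rho> permutes {..<M}"
  shows "vtx z w \<rho> (Suc l) = (vtx z w \<rho> l)(inv \<rho> l := w (inv \<rho> l))"
    and "vtx z w \<rho> l (inv \<rho> l) = z (inv \<rho> l)"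
proof -
  have "\<rho> (inv \<rho> l) = l" using permutes_inverses(1)[OF assms] .
  moreover have "\<rho> r = l \<longleftrightarrow> r = inv \<rho> l" for r
    using permutes_inv_eq[OF assms] by metis
  ultimately show "vtx z w \<rho> (Suc l) = (vtx z w \<rho> l)(inv \<rho> l := w (inv \<rho> l))"
    by (auto simp: vtx_def less_Suc_eq fun_eq_iff)
  show "vtx z w \<rho> l (inv \<rho> l) = z (inv \<rho> l)"
    by (simp add: vtx_def permutes_inverses(1)[OF assms])
qed

lemma step_model:
  assumes "\<rho> permutes {..<M}" "finite (\<gamma> e)"
  shows "step (model M b \<gamma>) (vtx z w \<rho>) e l =
    (if b (inv \<rho> l) \<in> \<gamma> e then top_sign M b (b (inv \<rho> l)) (vtx z w \<rho> l) +
       top_sign M b (b (inv \<rho> l)) (vtx z w \<rho> (Suc l)) else 0)"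
proof -
  have "top_sign M b j (vtx z w \<rho> l) + top_sign M b j (vtx z w \<rho> (Suc l)) = (if j = b (inv \<rho> l) then
      top_sign M b (b (inv \<rho> l)) (vtx z w \<rho> l) + top_sign M b (b (inv \<rho> l)) (vtx z w \<rho> (Suc l)) else 0)" for j
    by (cases "j = b (inv \<rho> l)") (simp_all add: vtx_Suc(1)[OF assms(1)] top_sign_upd_other)
  then show ?thesis
    using assms(2) by (simp add: step_def model_def sum.distrib[symmetric])
qed

lemma odd_card_Suc:
  "odd (card {r. r < Suc l \<and> b r = j}) \<longleftrightarrow> (odd (card {r. r < l \<and> b r = j}) \<longleftrightarrow> b l \<noteq> j)"
proof (cases "b l = j")
  case True
  then have "{r. r < Suc l \<and> b r = j} = insert l {r. r < l \<and> b r = j}" by (auto simp: less_Suc_eq)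
  then show ?thesis using True by simp
next
  case False
  then have "{r. r < Suc l \<and> b r = j} = {r. r < l \<and> b r = j}" by (auto simp: less_Suc_eq)
  then show ?thesis using False by simp
qed

text \<open>Each factor forces its move to change a top sign, so by \<open>top_sign_change\<close>
  the moving coordinate starts at 0 and no higher coordinate of its block has moved yet. Hence every
  block is filled in increasing order, which determines the order of the moves, the start and all
  signs.\<close>

lemma alternating_cell_unique:
  assumes cell: "(z, w, \<rho>) \<in> cells M L"
    and fin: "\<And>e. e < M \<Longrightarrow> finite (\<gamma> e)"
    and max: "\<And>e j. e < M \<Longrightarrow> j \<in> \<gamma> e \<Longrightarrow> j \<le> b e"
    and alt: "\<And>e. e < M \<Longrightarrow> step (model M b \<gamma>) (vtx z w \<rho>) e e \<noteq> 0"
  shows "\<rho> = (\<lambda>r. r)" "z = (\<lambda>_. 0)"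
    "w = (\<lambda>l. if l < M then if odd (card {r. r < Suc l \<and> b r = b l}) then 1 else -1 else 0)"
proof -
  note inv_ident = inv_id[unfolded id_def]
  let ?V = "vtx z w \<rho>"
  have p: "\<rho> permutes {..<M}" using cell by (simp add: cells_def)
  have zw: "even (z r)" "\<bar>w r - z r\<bar> = 1" if "r < M" for r
    using cell that by (auto simp: cells_def)
  have out: "z r = 0" "w r = 0" if "r \<ge> M" for r
    using cell that by (auto simp: cells_def grid_def)
  have inM: "inv \<rho> l < M" if "l < M" for l
    using permutes_in_image[OF permutes_inv[OF p], of l] that by simp
  have \<rho>M: "\<rho> l < M" if "l < M" for l
    using permutes_in_image[OF p, of l] that by simp
  have inv: "\<rho> (inv \<rho> l) = l" "inv \<rho> (\<rho> l) = l" for l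
    using permutes_inverses[OF p] by auto
  have mem: "b (inv \<rho> l) \<in> \<gamma> l"
    and ch: "top_sign M b (b (inv \<rho> l)) (?V (Suc l)) \<noteq> top_sign M b (b (inv \<rho> l)) (?V l)" if "l < M" for l
    using alt[OF that] unfolding step_model[of \<rho> M \<gamma> l b z w l, OF p fin[OF that]] by (auto split: if_splits)
  \<comment> \<open>The coordinate moved at step \<open>l\<close> has block index at most \<open>b l\<close>; as the sums agree, so do the indices.\<close>
  have "(\<Sum>l<M. b (inv \<rho> l)) = (\<Sum>l<M. b l)"
    using sum.permute[OF permutes_inv[OF p], of b] by (simp add: o_def)
  then have binv: "b (inv \<rho> l) = b l" if "l < M" for l
    using sum_mono_inv[of "\<lambda>l. b (inv \<rho> l)" "{..<M}" b l] mem max that by auto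
  have top: "z (inv \<rho> l) = 0 \<and> (\<forall>r'<M. inv \<rho> l < r' \<longrightarrow> b r' = b (inv \<rho> l) \<longrightarrow> ?V l r' = 0)" if "l < M" for l
    using top_sign_change[of "inv \<rho> l" M "?V l" "w (inv \<rho> l)" b] ch[OF that] inM[OF that] zw[OF inM[OF that]]
    unfolding vtx_Suc[OF p] by simp
  have mono: "\<rho> r < \<rho> r'" if "r < r'" "r' < M" "b r = b r'" for r r'
  proof -
    have "?V (\<rho> r) r' = 0"
      using top[of "\<rho> r"] \<rho>M[of r] that by (simp add: inv)
    moreover have "w r' \<noteq> 0" using zw[OF that(2)] by presburger
    ultimately have "\<rho> r \<le> \<rho> r'" by (auto simp: vtx_def split: if_splits)
    then show ?thesis using permutes_inj[OF p] that(1) by (metis inj_eq le_neq_implies_less less_irrefl)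
  qed
  \<comment> \<open>For the least \<open>r\<close> that is not fixed, \<open>inv \<rho> r\<close> is
    a larger coordinate of the same block that moves at time \<open>r\<close>, while
    \<open>r\<close> itself moves later, against \<open>mono\<close>.\<close>
  have "\<rho> r = r" if "r < M" for r
    using that
  proof (induction r rule: less_induct)
    case (less r)
    have IH: "\<rho> r' = r'" if "r' < r" for r'
      using less that by simp
    have 1: "r \<le> \<rho> r" using IH[of "\<rho> r"] inv(2) by (metis leI nat_neq_iff)
    have 2: "r \<le> inv \<rho> r" using IH[of "inv \<rho> r"] inv(1) by (metis leI nat_neq_iff)
    show ?case
    proof (rule ccontr)
      assume "\<rho> r \<noteq> r"
      then have "r < inv \<rho> r" using 2 inv by (metis le_neq_implies_less)
      then have "\<rho> r < \<rho> (inv \<rho> r)"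
        using mono[of r "inv \<rho> r"] binv less.prems inM by simp
      then show False using 1 inv by simp
    qed
  qed
  then show id: "\<rho> = (\<lambda>r. r)"
    using permutes_not_in[OF p] by (auto simp: fun_eq_iff)
  have V: "?V l r = (if r < l then w r else z r)" for l r by (simp add: vtx_def id)
  show z: "z = (\<lambda>_. 0)"
  proof
    fix r show "z r = 0" using top[of r] out by (cases "r < M") (auto simp: id inv_ident)
  qed
  have V0: "?V l r = (if r < l then w r else 0)" for l r using V z by simp
  have w: "\<bar>w r\<bar> = 1" if "r < M" for r using zw[OF that] by (simp add: z)
  have at: "top_sign M b (b l) (?V (Suc l)) = of_bool (w l > 0)" if "l < M" for l
    using top_sign_at_top[of l M "?V (Suc l)" b] w[OF that] that by (auto simp: V0)
  \<comment> \<open>The top sign of a block starts at 0, and each move inside the block toggles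
    it.\<close>
  have par: "top_sign M b j (?V l) = of_bool (odd (card {r. r < l \<and> b r = j}))" if "l \<le> M" for l j
    using that
  proof (induction l arbitrary: j)
    case 0
    show ?case by (simp add: top_sign_def V0)
  next
    case (Suc l)
    show ?case
    proof (cases "b l = j")
      case True
      then show ?thesis using ch[of l] Suc.IH[of j] Suc.prems odd_card_Suc[of l b j]
        by (cases "top_sign M b j (?V (Suc l))") (auto simp: id inv_ident)
    next
      case False
      have "?V (Suc l) = (?V l)(l := w l)"
        using vtx_Suc(1)[OF p, of z w l] by (simp only: id inv_ident)
      then have "top_sign M b j (?V (Suc l)) = top_sign M b j (?V l)"
        using False by (metis top_sign_upd_other)
      then show ?thesis using False Suc.IH[of j] Suc.prems odd_card_Suc[of l b j]
        by simp
    qed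
  qed
  show "w = (\<lambda>l. if l < M then if odd (card {r. r < Suc l \<and> b r = b l}) then 1 else -1 else 0)"
  proof
    fix l
    show "w l = (if l < M then if odd (card {r. r < Suc l \<and> b r = b l}) then 1 else -1 else 0)"
    proof (cases "l < M")
      case True
      have "w l > 0 \<longleftrightarrow> odd (card {r. r < Suc l \<and> b r = b l})"
        using at[OF True] par[of "Suc l" "b l"] True by (simp add: of_bool_def split: if_splits)
      then show ?thesis using w[OF True] True by auto
    qed (simp add: out)
  qed
qed

text \<open>With signs alternating inside each block, starting with +1, every move toggles the top
  sign of its block, and the move at time \<open>e\<close> takes place in block \<open>b e\<close>,
  which belongs to \<open>\<gamma> e\<close>.\<close>

lemma alternating_cell:
  fixes M b
  defines "w \<equiv> (\<lambda>l. if l < M then if odd (card {r. r < Suc l \<and> b r = b l}) then 1 else -1 else 0)"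
  assumes L: "0 < L"
    and fin: "\<And>e. e < M \<Longrightarrow> finite (\<gamma> e)"
    and max: "\<And>e. e < M \<Longrightarrow> b e \<in> \<gamma> e"
  shows "((\<lambda>_. 0), w, \<lambda>r. r) \<in> cells M L"
    and "e < M \<Longrightarrow> step (model M b \<gamma>) (vtx (\<lambda>_. 0) w (\<lambda>r. r)) e e = 1"
proof -
  show "((\<lambda>_. 0), w, \<lambda>r. r) \<in> cells M L"
    using L by (auto simp: cells_def grid_def w_def permutes_id[unfolded id_def])
  note inv_ident = inv_id[unfolded id_def]
  let ?V = "vtx (\<lambda>_. 0) w (\<lambda>r. r)"
  have p: "(\<lambda>r. r) permutes {..<M}" using permutes_id by (simp add: id_def)
  have w: "w l > 0 \<longleftrightarrow> odd (card {r. r < Suc l \<and> b r = b l})" if "l < M" for l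
    using that by (simp add: w_def)
  have at: "top_sign M b (b l) (?V (Suc l)) = of_bool (w l > 0)" if "l < M" for l
    using top_sign_at_top[of l M "?V (Suc l)" b] that by (auto simp: vtx_def w_def)
  have par: "top_sign M b j (?V l) = of_bool (odd (card {r. r < l \<and> b r = j}))" if "l \<le> M" for l j
    using that
  proof (induction l arbitrary: j)
    case 0
    show ?case by (simp add: top_sign_def vtx_def)
  next
    case (Suc l)
    show ?case
    proof (cases "b l = j")
      case True
      have l: "l < M" using Suc.prems by simp
      show ?thesis unfolding True[symmetric] at[OF l] w[OF l] ..
    next
      case False
      have "?V (Suc l) = (?V l)(l := w l)"
        using vtx_Suc(1)[OF p, of "\<lambda>_. 0" w l] by (simp only: inv_ident)
      then have "top_sign M b j (?V (Suc l)) = top_sign M b j (?V l)"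
        using False by (metis top_sign_upd_other)
      then show ?thesis using False Suc.IH[of j] Suc.prems odd_card_Suc[of l b j]
        by simp
    qed
  qed
  show "step (model M b \<gamma>) (vtx (\<lambda>_. 0) w (\<lambda>r. r)) e e = 1" if e: "e < M"
    using par[of e "b e"] par[of "Suc e" "b e"] e max[OF e] odd_card_Suc[of e b "b e"]
    unfolding step_model[of "\<lambda>r. r" M \<gamma> e b "\<lambda>_. 0" w e, OF p fin[OF e]] inv_ident by (auto simp: of_bool_def)
qed

lemma degree2_model:
  assumes L: "0 < L"
    and fin: "\<And>e. e < M \<Longrightarrow> finite (\<gamma> e)"
    and mem: "\<And>e. e < M \<Longrightarrow> b e \<in> \<gamma> e"
    and max: "\<And>e j. e < M \<Longrightarrow> j \<in> \<gamma> e \<Longrightarrow> j \<le> b e"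
  shows "degree2 M L (model M b \<gamma>) = 1"
proof -
  let ?w = "\<lambda>l. if l < M then if odd (card {r. r < Suc l \<and> b r = b l}) then 1 else - 1 :: int else 0"
  let ?c = "((\<lambda>_. 0), ?w, \<lambda>r. r)"
  let ?f = "\<lambda>(z, w, \<rho>). \<Prod>e<M. step (model M b \<gamma>) (vtx z w \<rho>) e e"
  have "degree2 M L (model M b \<gamma>) = (\<Sum>c\<in>cells M L. ?f c)"
    by (simp add: degree2_def cellsum_def)
  also have "\<dots> = (\<Sum>c\<in>{?c}. ?f c)"
  proof (rule sum.mono_neutral_right[OF finite_cells])
    show "{?c} \<subseteq> cells M L" using alternating_cell(1)[OF L fin mem] by simp
    show "\<forall>c\<in>cells M L - {?c}. ?f c = 0"
    proof (rule ballI, rule ccontr)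
      fix c assume c: "c \<in> cells M L - {?c}" and ne: "?f c \<noteq> 0"
      obtain z w \<rho> where zw: "c = (z, w, \<rho>)" by (cases c)
      have cell: "(z, w, \<rho>) \<in> cells M L" using c zw by simp
      have alt: "step (model M b \<gamma>) (vtx z w \<rho>) e e \<noteq> 0" if "e < M" for e
        using ne that by (auto simp: zw)
      have "\<rho> = (\<lambda>r. r)" "z = (\<lambda>_. 0)" "w = ?w"
        by (rule alternating_cell_unique[of z w \<rho> M L \<gamma> b, OF cell fin max alt]; assumption)+
      then have "c = ?c" by (simp only: zw)
      then show False using c by simp
    qed
  qed
  also have "\<dots> = (\<Prod>e<M. step (model M b \<gamma>) (vtx (\<lambda>_. 0) ?w (\<lambda>r. r)) e e)"
    by simp
  also have "\<dots> = 1"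
    by (rule prod.neutral) (use alternating_cell(2)[of L M \<gamma> b, OF L fin mem] in blast)
  finally show ?thesis .
qed

text \<open>The degree of \<open>s\<close> agrees with that of the model, which is 1, so some cell
  contributes a nonzero product. This plays the role of Tucker's lemma.\<close>

lemma alternating_cell_exists:
  assumes L: "even L" "0 < L"
    and fin: "\<And>e. e < M \<Longrightarrow> finite (\<gamma> e)"
    and mem: "\<And>e. e < M \<Longrightarrow> b e \<in> \<gamma> e"
    and max: "\<And>e j. e < M \<Longrightarrow> j \<in> \<gamma> e \<Longrightarrow> j \<le> b e"
    and s: "block_odd M L b \<gamma> s"
  obtains z w \<rho> where "(z, w, \<rho>) \<in> cells M L"
    "\<And>e. e < M \<Longrightarrow> s e (vtx z w \<rho> e) \<noteq> s e (vtx z w \<rho> (Suc e))"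
proof -
  have "degree2 M L s = 1"
    using degree2_cong[OF L s block_odd_model[of L M \<gamma> b, OF L(2) fin]]
      degree2_model[of L M \<gamma> b, OF L(2) fin mem max] by simp
  then have "(\<Sum>(z, w, \<rho>)\<in>cells M L. \<Prod>e<M. step s (vtx z w \<rho>) e e) \<noteq> 0"
    by (simp add: degree2_def cellsum_def)
  then obtain c where c: "c \<in> cells M L" "(case c of (z, w, \<rho>) \<Rightarrow> \<Prod>e<M. step s (vtx z w \<rho>) e e) \<noteq> 0"
    by (rule sum.not_neutral_contains_not_neutral)
  obtain z w \<rho> where zw: "c = (z, w, \<rho>)" by (cases c)
  have "s e (vtx z w \<rho> e) \<noteq> s e (vtx z w \<rho> (Suc e))" if "e < M" for e
  proof
    assume "s e (vtx z w \<rho> e) = s e (vtx z w \<rho> (Suc e))"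
    then have "step s (vtx z w \<rho>) e e = 0" by (simp add: step_def)
    then show False using c(2) that by (auto simp: zw)
  qed
  then show ?thesis using that c(1) zw by blast
qed

section \<open>From grids to a common zero\<close>

lemma tendsto_fun_iff:
  fixes f :: "'a \<Rightarrow> 'b \<Rightarrow> 'c::topological_space"
  shows "(f \<longlongrightarrow> l) F \<longleftrightarrow> (\<forall>i. ((\<lambda>c. f c i) \<longlongrightarrow> l i) F)"
  using limitin_componentwise[of "\<lambda>_. euclidean :: 'c topology" UNIV f l F]
  by (simp add: euclidean_product_topology limitin_canonical_iff)

lemma compact_fun_box:
  fixes K :: "'a \<Rightarrow> 'b::topological_space set"
  assumes "\<And>r. compact (K r)"
  shows "compact {x. \<forall>r. x r \<in> K r}"
proof -
  have "{x. \<forall>r. x r \<in> K r} = Pi\<^sub>E UNIV K" by (auto simp: PiE_def)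
  then show ?thesis
    using compactin_PiE[of "\<lambda>_. euclidean :: 'b topology" UNIV K] assms
    by (simp add: euclidean_product_topology)
qed

definition cube :: "nat \<Rightarrow> (nat \<Rightarrow> real) set" where
  "cube M = {x. (\<forall>r<M. \<bar>x r\<bar> \<le> 1) \<and> (\<forall>r\<ge>M. x r = 0)}"

lemma compact_cube: "compact (cube M)"
proof -
  have "x r \<in> (if r < M then {-1..1} else {0}) \<longleftrightarrow> (r < M \<longrightarrow> \<bar>x r\<bar> \<le> 1) \<and> (r \<ge> M \<longrightarrow> x r = 0)"
    for x :: "nat \<Rightarrow> real" and r
    by (simp add: abs_le_iff minus_le_iff conj_commute)
  then have "cube M = {x. \<forall>r. x r \<in> (if r < M then {-1..1} else {0})}"
    unfolding cube_def by (simp only: all_conj_distrib)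
  then show ?thesis using compact_fun_box[of "\<lambda>r. if r < M then {-1..1::real} else {0}"] by simp
qed

lemma vtx_dist:
  "(z, w, \<rho>) \<in> cells M L \<Longrightarrow> \<bar>vtx z w \<rho> l r - z r\<bar> \<le> 1"
  by (cases "r < M") (auto simp: cells_def vtx_def grid_def)

text \<open>Label the grid points by the signs of the \<open>f e\<close>. A cell on which all labels
  change has, for each \<open>e\<close>, two vertices where \<open>f e\<close> does not have the
  same strict sign. On finer grids such cells shrink, along a subsequence, to a point
  \<open>x\<close> with \<open>f e x * f e x \<le> 0\<close>.\<close>

proposition cube_common_zero:
  fixes f :: "nat \<Rightarrow> (nat \<Rightarrow> real) \<Rightarrow> real"
  assumes cont: "\<And>e. e < M \<Longrightarrow> continuous_on (cube M) (f e)"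
    and fin: "\<And>e. e < M \<Longrightarrow> finite (\<gamma> e)"
    and mem: "\<And>e. e < M \<Longrightarrow> b e \<in> \<gamma> e"
    and max: "\<And>e j. e < M \<Longrightarrow> j \<in> \<gamma> e \<Longrightarrow> j \<le> b e"
    and odd: "\<And>e x r. e < M \<Longrightarrow> x \<in> cube M \<Longrightarrow> r < M \<Longrightarrow> \<bar>x r\<bar> = 1 \<Longrightarrow>
      f e (flip b (b r) x) = (if b r \<in> \<gamma> e then - f e x else f e x)"
  obtains x where "x \<in> cube M" "\<And>e. e < M \<Longrightarrow> f e x = 0"
proof -
  \<comment> \<open>The grid has even size, as \<open>alternating_cell_exists\<close>
    requires.\<close>
  define L :: "nat \<Rightarrow> int" where "L N = 2 * int (Suc N)" for N
  have L: "even (L N)" "0 < L N" for N by (auto simp: L_def)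
  define scale :: "nat \<Rightarrow> (nat \<Rightarrow> int) \<Rightarrow> nat \<Rightarrow> real"
    where "scale N v r = of_int (v r) / of_int (L N)" for N v r
  have scale_cube: "scale N v \<in> cube M" if "v \<in> grid M (L N)" for N v
    using that L[of N] by (auto simp: cube_def grid_def scale_def)
  have scale_flip: "scale N (flip b j v) = flip b j (scale N v)" for N j v
    by (auto simp: scale_def flip_def)
  \<comment> \<open>Ties are broken by the model so that \<open>s\<close> stays equivariant where \<open>f e\<close> vanishes.\<close>
  define s where "s N e v = (if f e (scale N v) > 0 then 1 else if f e (scale N v) < 0 then 0
      else model M b \<gamma> e v)" for N e v
  have "block_odd M (L N) b \<gamma> (s N)" for N
    unfolding block_odd_def
  proof (intro allI impI ballI)
    fix e v r assume e: "e < M" and v: "v \<in> grid M (L N)" and r: "r < M" "\<bar>v r\<bar> = L N"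
    have "\<bar>scale N v r\<bar> = 1" using r L[of N] by (simp add: scale_def flip: of_int_abs)
    then have *: "f e (scale N (flip b (b r) v)) =
        (if b r \<in> \<gamma> e then - f e (scale N v) else f e (scale N v))"
      unfolding scale_flip using odd e r scale_cube[OF v] by blast
    have "model M b \<gamma> e (flip b (b r) v) = model M b \<gamma> e v + of_bool (b r \<in> \<gamma> e)"
      using block_odd_model[of "L N" M \<gamma> b, OF L(2) fin] e v r unfolding block_odd_def by blast
    then show "s N e (flip b (b r) v) = s N e v + of_bool (b r \<in> \<gamma> e)"
      using * by (auto simp: s_def)
  qed
  then have "\<exists>z w \<rho>. (z, w, \<rho>) \<in> cells M (L N) \<and>
      (\<forall>e<M. s N e (vtx z w \<rho> e) \<noteq> s N e (vtx z w \<rho> (Suc e)))" for N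
    using alternating_cell_exists[of "L N" M \<gamma> b "s N", OF L fin mem max] by metis
  then obtain z w \<rho> where cell: "\<And>N. (z N, w N, \<rho> N) \<in> cells M (L N)"
    and alt: "\<And>N e. e < M \<Longrightarrow> s N e (vtx (z N) (w N) (\<rho> N) e) \<noteq> s N e (vtx (z N) (w N) (\<rho> N) (Suc e))"
    by metis
  define P where "P l N = scale N (vtx (z N) (w N) (\<rho> N) l)" for l N
  have P_cube: "P l N \<in> cube M" for l N
    unfolding P_def by (intro scale_cube vtx_grid cell)
  have "f e (P e N) * f e (P (Suc e) N) \<le> 0" if "e < M" for e N
  proof (rule ccontr)
    assume "\<not> ?thesis"
    then have "(f e (P e N) > 0 \<and> f e (P (Suc e) N) > 0) \<or> (f e (P e N) < 0 \<and> f e (P (Suc e) N) < 0)"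
      by (simp add: not_le zero_less_mult_iff)
    then show False using alt[OF that, of N] by (auto simp: s_def P_def)
  qed
  note neg = this
  obtain x \<sigma> where x: "x \<in> cube M" and \<sigma>: "strict_mono \<sigma>" "(P 0 \<circ> \<sigma>) \<longlonglongrightarrow> x"
    using compact_cube[of M] P_cube[of 0] unfolding compact_eq_seq_compact_metric seq_compact_def
    by metis
  have lim: "(\<lambda>n. P l (\<sigma> n)) \<longlonglongrightarrow> x" for l
    unfolding tendsto_fun_iff
  proof
    fix r
    have 0: "(\<lambda>n. P 0 (\<sigma> n) r) \<longlonglongrightarrow> x r"
      using \<sigma>(2) by (simp add: tendsto_fun_iff o_def)
    have "\<bar>P l N r - P 0 N r\<bar> \<le> 1 / real (Suc N)" for N
    proof -
      have v0: "vtx (z N) (w N) (\<rho> N) 0 r = z N r" by (simp add: vtx_def)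
      have "P l N r - P 0 N r = of_int (vtx (z N) (w N) (\<rho> N) l r - z N r) / of_int (L N)"
        by (simp add: P_def scale_def v0 diff_divide_distrib)
      then have "\<bar>P l N r - P 0 N r\<bar> = of_int \<bar>vtx (z N) (w N) (\<rho> N) l r - z N r\<bar> / of_int (L N)"
        using L(2)[of N] by (simp add: abs_divide)
      also have "\<dots> \<le> 1 / of_int (L N)"
        using vtx_dist[OF cell, of N l r] L(2)[of N]
        by (intro divide_right_mono) (simp_all flip: of_int_abs)
      also have "\<dots> \<le> 1 / real (Suc N)"
        by (intro divide_left_mono) (auto simp: L_def)
      finally show ?thesis .
    qed
    then have "(\<lambda>N. P l N r - P 0 N r) \<longlonglongrightarrow> 0"
      by (intro Lim_null_comparison[OF _ LIMSEQ_Suc[OF lim_1_over_n]]) (auto intro!: always_eventually)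
    then have "(\<lambda>n. P l (\<sigma> n) r - P 0 (\<sigma> n) r) \<longlonglongrightarrow> 0"
      using LIMSEQ_subseq_LIMSEQ[OF _ \<sigma>(1)] by (fastforce simp: o_def)
    from tendsto_add[OF this 0] show "(\<lambda>n. P l (\<sigma> n) r) \<longlonglongrightarrow> x r" by simp
  qed
  have "f e x = 0" if e: "e < M" for e
  proof -
    have "(\<lambda>n. f e (P l (\<sigma> n))) \<longlonglongrightarrow> f e x" for l
      using continuous_on_tendsto_compose[OF cont[OF e] lim x] P_cube by auto
    then have "(\<lambda>n. f e (P e (\<sigma> n)) * f e (P (Suc e) (\<sigma> n))) \<longlonglongrightarrow> f e x * f e x"
      by (intro tendsto_mult)
    then have "f e x * f e x \<le> 0"
      by (rule LIMSEQ_le_const2) (use neg[OF e] in auto)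
    then show ?thesis
      by (metis mult_le_0_iff order_antisym)
  qed
  with x show ?thesis using that by blast
qed

section \<open>Unconditional gauges and Lozanovskii's scaling\<close>

text \<open>The first clause also makes \<open>q\<close> blind to the coordinates from
  \<open>k\<close> on. Definiteness is assumed separately where a norm is built from a
  gauge.\<close>

definition uncond_gauge :: "nat \<Rightarrow> ((nat \<Rightarrow> real) \<Rightarrow> real) \<Rightarrow> bool" where
  "uncond_gauge k q \<longleftrightarrow>
     (\<forall>y y'. (\<forall>i<k. \<bar>y i\<bar> = \<bar>y' i\<bar>) \<longrightarrow> q y = q y') \<and>
     (\<forall>c y. q (\<lambda>i. c * y i) = \<bar>c\<bar> * q y) \<and>
     (\<forall>y y'. q (\<lambda>i. y i + y' i) \<le> q y + q y')"

context
  fixes k :: nat and q :: "(nat \<Rightarrow> real) \<Rightarrow> real"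
  assumes q: "uncond_gauge k q"
begin

lemma gauge_cong: "(\<And>i. i < k \<Longrightarrow> \<bar>y i\<bar> = \<bar>y' i\<bar>) \<Longrightarrow> q y = q y'"
  using q unfolding uncond_gauge_def by blast

lemma gauge_scale: "q (\<lambda>i. c * y i) = \<bar>c\<bar> * q y"
  using q unfolding uncond_gauge_def by blast

lemma gauge_add: "q (\<lambda>i. y i + y' i) \<le> q y + q y'"
  using q unfolding uncond_gauge_def by blast

lemma gauge_zero: "(\<And>i. i < k \<Longrightarrow> y i = 0) \<Longrightarrow> q y = 0"
  using gauge_cong[of y "\<lambda>i. 0 * y i"] gauge_scale[of 0 y] by simp

lemma gauge_nonneg: "0 \<le> q y"
  using gauge_add[of y "\<lambda>i. - y i"] gauge_cong[of "\<lambda>i. - y i" y] gauge_zero[of "\<lambda>i. y i + - y i"]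
  by simp

text \<open>Coordinates are exchanged one at a time: \<open>y m\<close> is a convex combination of
  \<open>y' m\<close> and \<open>- y' m\<close>, and the vectors with these two entries have the
  same gauge.\<close>

lemma gauge_mono:
  assumes le: "\<And>i. i < k \<Longrightarrow> \<bar>y i\<bar> \<le> \<bar>y' i\<bar>"
  shows "q y \<le> q y'"
proof -
  have "q (\<lambda>i. if i < m then y i else y' i) \<le> q y'" if "m \<le> k" for m
    using that
  proof (induction m)
    case (Suc m)
    define v where "v i = (if i < m then y i else y' i)" for i
    have v': "(\<lambda>i. if i < Suc m then y i else y' i) = v(m := y m)"
      by (auto simp: v_def fun_eq_iff less_Suc_eq)
    have le': "\<bar>y m\<bar> \<le> \<bar>y' m\<bar>" using le Suc by simp
    have "q (v(m := y m)) \<le> q v"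
    proof (cases "y' m = 0")
      case True
      then show ?thesis using le' by (intro eq_refl gauge_cong) (auto simp: v_def)
    next
      case False
      define t where "t = y m / y' m"
      have t: "\<bar>t\<bar> \<le> 1" using le' False by (simp add: t_def abs_divide)
      have v: "v(m := y m) = (\<lambda>i. (1 + t) / 2 * v i + (1 - t) / 2 * (v(m := - y' m)) i)"
        using False by (auto simp: fun_eq_iff v_def t_def field_simps)
      have "q (v(m := y m)) \<le> \<bar>(1 + t) / 2\<bar> * q v + \<bar>(1 - t) / 2\<bar> * q (v(m := - y' m))"
        unfolding v by (rule order_trans[OF gauge_add]) (simp only: gauge_scale order_refl)
      also have "q (v(m := - y' m)) = q v"
        by (rule gauge_cong) (auto simp: v_def)
      also have "\<bar>(1 + t) / 2\<bar> * q v + \<bar>(1 - t) / 2\<bar> * q v = q v"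
      proof -
        have "\<bar>(1 + t) / 2\<bar> = (1 + t) / 2" "\<bar>(1 - t) / 2\<bar> = (1 - t) / 2" using t by auto
        then show ?thesis by (simp add: field_simps)
      qed
      finally show ?thesis .
    qed
    then show ?case using Suc unfolding v' by (simp add: v_def[abs_def])
  qed simp
  from this[of k] have "q (\<lambda>i. if i < k then y i else y' i) \<le> q y'" by simp
  also have "q (\<lambda>i. if i < k then y i else y' i) = q y" by (rule gauge_cong) simp
  finally show ?thesis .
qed

lemma gauge_le_sum: "q y \<le> (\<Sum>i<k. \<bar>y i\<bar> * q (\<lambda>r. of_bool (r = i)))"
proof -
  have "q (\<lambda>i. if i < m then y i else 0) \<le> (\<Sum>i<m. \<bar>y i\<bar> * q (\<lambda>r. of_bool (r = i)))" for m
  proof (induction m)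
    case (Suc m)
    have "(\<lambda>i. if i < Suc m then y i else 0) = (\<lambda>i. (if i < m then y i else 0) + y m * of_bool (i = m))"
      by (auto simp: less_Suc_eq)
    then have "q (\<lambda>i. if i < Suc m then y i else 0) \<le>
        q (\<lambda>i. if i < m then y i else 0) + \<bar>y m\<bar> * q (\<lambda>r. of_bool (r = m))"
      using gauge_add[of "\<lambda>i. if i < m then y i else 0" "\<lambda>i. y m * of_bool (i = m)"]
      unfolding gauge_scale by simp
    then show ?case using Suc by simp
  qed (simp add: gauge_zero)
  from this[of k] have "q (\<lambda>i. if i < k then y i else 0) \<le> (\<Sum>i<k. \<bar>y i\<bar> * q (\<lambda>r. of_bool (r = i)))" .
  also have "q (\<lambda>i. if i < k then y i else 0) = q y" by (rule gauge_cong) simp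
  finally show ?thesis .
qed

lemma gauge_diff: "\<bar>q y - q y'\<bar> \<le> q (\<lambda>i. y i - y' i)"
  using gauge_add[of y' "\<lambda>i. y i - y' i"] gauge_add[of y "\<lambda>i. y' i - y i"]
    gauge_cong[of "\<lambda>i. y' i - y i" "\<lambda>i. y i - y' i"]
  by (simp add: abs_le_iff abs_minus_commute)

lemma continuous_gauge: "continuous_on UNIV q"
  unfolding continuous_on_def
proof
  fix x :: "nat \<Rightarrow> real"
  have 1: "((\<lambda>y. y i) \<longlongrightarrow> x i) (at x)" for i
    using continuous_on_product_coordinates[of i]
    by (auto simp: continuous_on_def)
  have "((\<lambda>y. \<Sum>i<k. \<bar>y i - x i\<bar> * q (\<lambda>r. of_bool (r = i))) \<longlongrightarrow>
      (\<Sum>i<k. \<bar>x i - x i\<bar> * q (\<lambda>r. of_bool (r = i)))) (at x)"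
    by (intro tendsto_intros 1)
  then have "((\<lambda>y. \<Sum>i<k. \<bar>y i - x i\<bar> * q (\<lambda>r. of_bool (r = i))) \<longlongrightarrow> 0) (at x)" by simp
  then have "((\<lambda>y. q y - q x) \<longlongrightarrow> 0) (at x)"
    by (rule Lim_null_comparison[rotated])
       (use order_trans[OF gauge_diff gauge_le_sum] in \<open>auto intro!: always_eventually\<close>)
  then show "(q \<longlongrightarrow> q x) (at x within UNIV)" by (simp add: LIM_zero_iff)
qed

end

text \<open>The last clause says that the hyperplane \<open>(\<Sum>i<k. y i / s i) = k\<close>
  supports the unit ball at \<open>s\<close>, the first-order condition for a maximal product of
  coordinates. These are closed conditions on \<open>q\<close> and \<open>s\<close>, which gives
  access to continuous dependence.\<close>

definition lozanovskii :: "nat \<Rightarrow> ((nat \<Rightarrow> real) \<Rightarrow> real) \<Rightarrow> (nat \<Rightarrow> real) \<Rightarrow> bool" where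
  "lozanovskii k q s \<longleftrightarrow> (\<forall>i<k. 1 / k \<le> s i \<and> s i \<le> 1) \<and> (\<forall>i\<ge>k. s i = 0) \<and> q s \<le> 1 \<and>
     (\<forall>y. (\<Sum>i<k. \<bar>y i\<bar> / s i) \<le> k * q y)"

text \<open>Insert \<open>s'\<close> in the bound for \<open>s\<close> and conversely: the sums of
  \<open>s' i / s i\<close> and of \<open>s i / s' i\<close> are at most \<open>k\<close>, while
  \<open>t + 1 / t \<ge> 2\<close> with equality only at \<open>t = 1\<close>.\<close>

lemma lozanovskii_unique:
  assumes s: "lozanovskii k q s" and s': "lozanovskii k q s'" and k: "0 < k"
  shows "s = s'"
proof
  fix i
  have pos: "0 < s i" "0 < s' i" if "i < k" for i
  proof -
    have "0 < 1 / real k" using k by simp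
    moreover have "1 / real k \<le> s i" "1 / real k \<le> s' i"
      using s s' that unfolding lozanovskii_def by blast+
    ultimately show "0 < s i" "0 < s' i" by linarith+
  qed
  define r where "r i = s' i / s i + s i / s' i - 2" for i
  have r: "r i = (s' i - s i)^2 / (s i * s' i)" if "i < k" for i
    using pos[OF that] by (simp add: r_def field_simps power2_eq_square)
  then have r0: "0 \<le> r i" if "i < k" for i
    using pos[OF that] that by simp
  have "(\<Sum>i<k. \<bar>s' i\<bar> / s i) \<le> k * q s'" "(\<Sum>i<k. \<bar>s i\<bar> / s' i) \<le> k * q s"
    using s s' unfolding lozanovskii_def by blast+
  moreover have "k * q s' \<le> k" "k * q s \<le> k"
    using s s' unfolding lozanovskii_def by (simp_all add: mult_left_le)
  moreover have "(\<Sum>i<k. \<bar>s' i\<bar> / s i) = (\<Sum>i<k. s' i / s i)" "(\<Sum>i<k. \<bar>s i\<bar> / s' i) = (\<Sum>i<k. s i / s' i)"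
    using pos by (auto intro!: sum.cong simp: abs_of_pos)
  ultimately have "(\<Sum>i<k. r i) \<le> 0"
    by (simp add: r_def sum.distrib sum_subtractf)
  moreover have "0 \<le> (\<Sum>i<k. r i)" by (rule sum_nonneg) (use r0 in auto)
  ultimately have "(\<Sum>i<k. r i) = 0" by simp
  then have "r i = 0" if "i < k" for i
    using that r0 sum_nonneg_eq_0_iff[of "{..<k}" r] by auto
  then have "s i = s' i" if "i < k" using r[OF that] pos[OF that] that by simp
  moreover have "s i = s' i" if "\<not> i < k" using s s' that by (simp add: lozanovskii_def)
  ultimately show "s i = s' i" by blast
qed

text \<open>The sum is the derivative of the product at \<open>t = 0\<close>; if it were positive,
  the product would exceed 1 for small \<open>t > 0\<close>.\<close>

lemma sum_nonpos_of_prod_le_1: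
  fixes c :: "'a \<Rightarrow> real"
  assumes "\<And>t. 0 \<le> t \<Longrightarrow> t \<le> 1 \<Longrightarrow> (\<Prod>i\<in>A. 1 + t * c i) \<le> 1"
  shows "(\<Sum>i\<in>A. c i) \<le> 0"
proof (rule ccontr)
  assume "\<not> ?thesis"
  then have pos: "0 < (\<Sum>i\<in>A. c i)" by simp
  have "((\<lambda>t. \<Prod>i\<in>A. 1 + t * c i) has_real_derivative (\<Sum>i\<in>A. c i * (\<Prod>j\<in>A-{i}. 1 + 0 * c j))) (at 0)"
    by (rule has_field_derivative_prod) (auto intro!: derivative_eq_intros)
  then have "((\<lambda>t. \<Prod>i\<in>A. 1 + t * c i) has_real_derivative (\<Sum>i\<in>A. c i)) (at 0)" by simp
  from DERIV_pos_inc_right[OF this pos] obtain d where d: "d > 0"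
    "\<And>h. 0 < h \<Longrightarrow> h < d \<Longrightarrow> 1 < (\<Prod>i\<in>A. 1 + h * c i)" by auto
  have "0 < min (d / 2) 1" "min (d / 2) 1 < d" "min (d/2) 1 \<le> 1" using d(1) by auto
  then show False using d(2)[of "min (d / 2) 1"] assms[of "min (d / 2) 1"] by linarith
qed

text \<open>Take \<open>s\<close> with maximal product of coordinates in the nonnegative part of the
  unit ball. On the segment from \<open>s\<close> to \<open>\<bar>y\<bar>\<close>, for
  \<open>y\<close> in the ball, the product never exceeds its value at \<open>s\<close>, and
  \<open>sum_nonpos_of_prod_le_1\<close> turns this into the supporting hyperplane.\<close>

lemma lozanovskii_exists:
  assumes q: "uncond_gauge k q" and k: "0 < k"
    and lower: "\<And>y i. i < k \<Longrightarrow> \<bar>y i\<bar> \<le> q y"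
    and unit: "\<And>i. i < k \<Longrightarrow> q (\<lambda>r. of_bool (r = i)) \<le> 1"
  shows "\<exists>s. lozanovskii k q s"
proof -
  define K where "K = {y. \<forall>r. y r \<in> (if r < k then {0..1::real} else {0})} \<inter> {y. q y \<le> 1}"
  have "compact K"
    unfolding K_def
  proof (rule compact_Int_closed)
    show "compact {y. \<forall>r. y r \<in> (if r < k then {0..1::real} else {0})}"
      by (rule compact_fun_box) simp
    show "closed {y. q y \<le> 1}"
      using continuous_gauge[OF q] by (intro closed_Collect_le) auto
  qed
  moreover have "K \<noteq> {}"
    using gauge_zero[OF q, of "\<lambda>_. 0"] by (auto simp: K_def intro!: exI[of _ "\<lambda>_. 0"])
  moreover have "continuous_on K (\<lambda>y. \<Prod>i<k. y i)"
    by (intro continuous_intros continuous_on_subset[OF continuous_on_product_coordinates]) auto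
  ultimately obtain s where s: "s \<in> K" and smax: "\<And>y. y \<in> K \<Longrightarrow> (\<Prod>i<k. y i) \<le> (\<Prod>i<k. s i)"
    using continuous_attains_sup by metis
  have KI: "y \<in> K" if "\<And>i. i < k \<Longrightarrow> 0 \<le> y i" "\<And>i. i \<ge> k \<Longrightarrow> y i = 0" "q y \<le> 1" for y
    using that lower[of _ y] by (fastforce simp: K_def)
  have s01: "0 \<le> s i" "s i \<le> 1" if "i < k" for i using s that by (auto simp: K_def split: if_splits) 
  have sout: "s i = 0" if "i \<ge> k" for i using s that by (auto simp: K_def dest!: spec[of _ i])
  have qs: "q s \<le> 1" using s by (simp add: K_def)
  \<comment> \<open>A small multiple of the all-ones vector lies in \<open>K\<close>, so the maximum
    is positive and no \<open>s i\<close> vanishes. The summand 1 keeps the denominator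
    positive.\<close>
  define c where "c = 1 / (1 + q (\<lambda>i. of_bool (i < k)))"
  have c: "0 < c" using gauge_nonneg[OF q, of "\<lambda>i. of_bool (i < k)"] by (simp add: c_def)
  have "q (\<lambda>i. c * of_bool (i < k)) = c * q (\<lambda>i. of_bool (i < k))"
    using gauge_scale[OF q, of c] c by simp
  also have "\<dots> \<le> 1"
    using gauge_nonneg[OF q, of "\<lambda>i. of_bool (i < k)"] by (simp add: c_def)
  finally have "(\<lambda>i. c * of_bool (i < k)) \<in> K"
    using c by (intro KI) auto
  from smax[OF this] have "c ^ k \<le> (\<Prod>i<k. s i)" by simp
  then have prod_pos: "0 < (\<Prod>i<k. s i)" using c by (meson less_le_trans zero_less_power)
  then have pos: "0 < s i" if "i < k" for i
    using s01[OF that] that by (metis finite_lessThan lessThan_iff order_le_less prod_zero_iff less_irrefl)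
  have main: "(\<Sum>i<k. \<bar>y i\<bar> / s i) \<le> k" if y: "q y \<le> 1" for y
  proof -
    have "(\<Sum>i<k. \<bar>y i\<bar> / s i - 1) \<le> 0"
    proof (rule sum_nonpos_of_prod_le_1)
      fix t :: real assume t: "0 \<le> t" "t \<le> 1"
      define v where "v i = (1 - t) * s i + t * (of_bool (i < k) * \<bar>y i\<bar>)" for i
      have "q v \<le> (1 - t) * q s + t * q (\<lambda>i. of_bool (i < k) * \<bar>y i\<bar>)"
        using gauge_add[OF q, of "\<lambda>i. (1 - t) * s i" "\<lambda>i. t * (of_bool (i < k) * \<bar>y i\<bar>)"] t
        unfolding gauge_scale[OF q] by (simp add: v_def[abs_def])
      also have "q (\<lambda>i. of_bool (i < k) * \<bar>y i\<bar>) = q y"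
        by (rule gauge_cong[OF q]) simp
      also have "(1 - t) * q s + t * q y \<le> (1 - t) * 1 + t * 1"
        using qs y t by (intro add_mono mult_left_mono) auto
      finally have "q v \<le> 1" by simp
      moreover have "0 \<le> v i" if "i < k" for i using t s01[OF that] by (simp add: v_def)
      moreover have "v i = 0" if "i \<ge> k" for i using sout that by (simp add: v_def)
      ultimately have "v \<in> K" by (intro KI)
      then have "(\<Prod>i<k. v i) \<le> (\<Prod>i<k. s i)" by (rule smax)
      moreover have "(\<Prod>i<k. v i) = (\<Prod>i<k. s i * (1 + t * (\<bar>y i\<bar> / s i - 1)))"
      proof (rule prod.cong)
        fix i assume "i \<in> {..<k}"
        then show "v i = s i * (1 + t * (\<bar>y i\<bar> / s i - 1))"
          using pos[of i] by (simp add: v_def field_simps)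
      qed simp
      ultimately show "(\<Prod>i<k. 1 + t * (\<bar>y i\<bar> / s i - 1)) \<le> 1"
        using prod_pos by (simp add: prod.distrib)
    qed
    then show ?thesis by (simp add: sum_subtractf)
  qed
  have bound: "(\<Sum>i<k. \<bar>y i\<bar> / s i) \<le> k * q y" for y
  proof (cases "q y = 0")
    case True
    then have "y i = 0" if "i < k" for i using lower[OF that, of y] by simp
    then show ?thesis using True by simp
  next
    case False
    then have qy: "0 < q y" using gauge_nonneg[OF q, of y] by simp
    have "q (\<lambda>i. 1 / q y * y i) \<le> 1"
      unfolding gauge_scale[OF q] using qy by simp
    then have "(\<Sum>i<k. \<bar>1 / q y * y i\<bar> / s i) \<le> k"
      by (rule main)
    also have "(\<Sum>i<k. \<bar>1 / q y * y i\<bar> / s i) = (\<Sum>i<k. \<bar>y i\<bar> / s i) / q y"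
      using qy by (simp add: sum_divide_distrib abs_mult mult.commute)
    finally show ?thesis using qy by (simp add: field_simps)
  qed
  have "1 / k \<le> s i" if "i < k" for i
  proof -
    \<comment> \<open>Testing the hyperplane bound with a unit vector, whose gauge is at most 1,
      bounds \<open>s i\<close> from below.\<close>
    have "1 / s i = (\<Sum>j<k. \<bar>of_bool (j = i)\<bar> / s j)"
      using that by (simp add: of_bool_def if_distrib[of "\<lambda>x. x / _"] if_distrib[of abs] cong: if_cong)
    also have "\<dots> \<le> k * q (\<lambda>r. of_bool (r = i))" by (rule bound)
    also have "\<dots> \<le> k" using unit[OF that] by (simp add: mult_left_le)
    finally show ?thesis using pos[OF that] k by (simp add: field_simps)
  qed
  then show ?thesis
    using s01 sout qs bound unfolding lozanovskii_def by blast
qed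

section \<open>Averaging over signs\<close>

text \<open>A sign vector is given by the set of its negative entries; products of sign vectors
  become symmetric differences.\<close>

definition sg :: "nat set \<Rightarrow> nat \<Rightarrow> real" where
  "sg D i = (if i \<in> D then -1 else 1)"

lemma sg_simps [simp]: "\<bar>sg D i\<bar> = 1" "sg D i * sg D i = 1" "sg {} i = 1"
  by (auto simp: sg_def)

lemma sg_sym_diff: "sg (sym_diff D E) i = sg D i * sg E i"
  by (auto simp: sg_def)

lemma sum_sym_diff:
  "E \<subseteq> K \<Longrightarrow> (\<Sum>D\<in>Pow K. g (sym_diff D E)) = (\<Sum>D\<in>Pow K. g D)"
  by (rule sum.reindex_bij_witness[of _ "\<lambda>D. sym_diff D E" "\<lambda>D. sym_diff D E"])
     (auto intro!: arg_cong[where f = g])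

definition sign_avg :: "nat \<Rightarrow> ((nat \<Rightarrow> real) \<Rightarrow> real) \<Rightarrow> (nat \<Rightarrow> real) \<Rightarrow> real" where
  "sign_avg k Q y = (\<Sum>D\<in>Pow {..<k}. Q (\<lambda>i. sg D i * y i)) / 2 ^ k"

text \<open>The unnormalised Walsh coefficient of \<open>Q (\<lambda>i. sg D i * y i)\<close>, as a
  function of \<open>D\<close>, at the character given by \<open>X\<close>.\<close>

definition sign_coeff :: "nat \<Rightarrow> nat set \<Rightarrow> ((nat \<Rightarrow> real) \<Rightarrow> real) \<Rightarrow> (nat \<Rightarrow> real) \<Rightarrow> real" where
  "sign_coeff k X Q y = (\<Sum>D\<in>Pow {..<k}. (\<Prod>i\<in>X. sg D i) * Q (\<lambda>i. sg D i * y i))"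

text \<open>Shifting \<open>D\<close> by \<open>{j}\<close> in the sum reproduces the coefficient up
  to the value of the character \<open>X\<close> at this shift.\<close>

lemma sign_coeff_flip:
  assumes j: "j < k" and X: "finite X"
  shows "sign_coeff k X (\<lambda>y. Q (\<lambda>i. sg {j} i * y i)) y = (if j \<in> X then -1 else 1) * sign_coeff k X Q y"
proof -
  have char: "(\<Prod>i\<in>X. sg {j} i) = (if j \<in> X then -1 else 1)"
  proof (cases "j \<in> X")
    case True
    then have "(\<Prod>i\<in>X. sg {j} i) = sg {j} j * (\<Prod>i\<in>X-{j}. sg {j} i)"
      by (rule prod.remove[OF X])
    also have "(\<Prod>i\<in>X-{j}. sg {j} i) = 1" by (rule prod.neutral) (auto simp: sg_def)
    finally show ?thesis using True by (simp add: sg_def)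
  next
    case False
    then show ?thesis by (auto simp: sg_def intro!: prod.neutral)
  qed
  have "sign_coeff k X (\<lambda>y. Q (\<lambda>i. sg {j} i * y i)) y =
      (\<Sum>D\<in>Pow {..<k}. (\<Prod>i\<in>X. sg {j} i) * ((\<Prod>i\<in>X. sg (sym_diff D {j}) i) * Q (\<lambda>i. sg (sym_diff D {j}) i * y i)))"
    unfolding sign_coeff_def
  proof (rule sum.cong[OF refl])
    fix D
    have 1: "(\<Prod>i\<in>X. sg {j} i) * (\<Prod>i\<in>X. sg (sym_diff D {j}) i) = (\<Prod>i\<in>X. sg D i)"
      unfolding sg_sym_diff prod.distrib[symmetric]
      by (intro prod.cong) (auto simp: sg_def)
    have 2: "(\<lambda>i. sg {j} i * (sg D i * y i)) = (\<lambda>i. sg (sym_diff D {j}) i * y i)"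
      unfolding sg_sym_diff by (simp add: mult_ac)
    show "(\<Prod>i\<in>X. sg D i) * Q (\<lambda>i. sg {j} i * (sg D i * y i)) =
        (\<Prod>i\<in>X. sg {j} i) * ((\<Prod>i\<in>X. sg (sym_diff D {j}) i) * Q (\<lambda>i. sg (sym_diff D {j}) i * y i))"
      unfolding 2 1[symmetric] by (rule mult.assoc)
  qed
  also have "\<dots> = (\<Prod>i\<in>X. sg {j} i) * sign_coeff k X Q y"
    unfolding sum_distrib_left[symmetric] sign_coeff_def
    using sum_sym_diff[of "{j}" "{..<k}" "\<lambda>D. (\<Prod>i\<in>X. sg D i) * Q (\<lambda>i. sg D i * y i)"] j by simp
  finally show ?thesis unfolding char .
qed

lemma sign_avg_flip:
  "j < k \<Longrightarrow> sign_avg k (\<lambda>y. Q (\<lambda>i. sg {j} i * y i)) y = sign_avg k Q y"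
  using sign_coeff_flip[of j k "{}" Q y] by (simp add: sign_coeff_def sign_avg_def)

text \<open>Fourier inversion on the group of sign changes: only the trivial character survives, so
  the function of the signs is constant and equals its mean.\<close>

lemma sign_coeff_zero_imp_invariant:
  assumes zero: "\<And>X. X \<subseteq> {..<k} \<Longrightarrow> X \<noteq> {} \<Longrightarrow> sign_coeff k X Q y = 0" and D: "D \<subseteq> {..<k}"
  shows "Q (\<lambda>i. sg D i * y i) = sign_avg k Q y"
proof -
  let ?P = "Pow {..<k}" and ?Q = "\<lambda>D. Q (\<lambda>i. sg D i * y i)"
  \<comment> \<open>The sum over \<open>X\<close> factors over the coordinates, and the factor at an
    \<open>i\<close> where \<open>D\<close> and \<open>D'\<close> disagree is
    \<open>-1 + 1\<close>.\<close>
  have orth: "(\<Sum>X\<in>?P. (\<Prod>i\<in>X. sg D i) * (\<Prod>i\<in>X. sg D' i)) = (if D' = D then 2 ^ k else 0)"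
    if D': "D' \<in> ?P" for D'
  proof -
    have "(\<Sum>X\<in>?P. (\<Prod>i\<in>X. sg D i) * (\<Prod>i\<in>X. sg D' i)) = (\<Prod>i<k. sg D i * sg D' i + 1)"
      by (simp add: prod_add prod.distrib)
    also have "\<dots> = (if D' = D then 2 ^ k else 0)"
    proof (cases "D' = D")
      case False
      then obtain i where "(i \<in> D) \<noteq> (i \<in> D')" by auto
      then have "i < k" "sg D i * sg D' i + 1 = 0"
        using D D' by (auto simp: sg_def)
      then have "(\<Prod>i<k. sg D i * sg D' i + 1) = 0" by (intro prod_zero) auto
      then show ?thesis using False by simp
    qed simp
    finally show ?thesis .
  qed
  have "(\<Sum>X\<in>?P. (\<Prod>i\<in>X. sg D i) * sign_coeff k X Q y) =
      (\<Sum>X\<in>?P. if X = {} then sign_coeff k {} Q y else 0)"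
    by (rule sum.cong) (auto simp: zero)
  also have "\<dots> = sign_coeff k {} Q y" by simp
  also have "\<dots> = 2 ^ k * sign_avg k Q y" by (simp add: sign_coeff_def sign_avg_def)
  finally have "2 ^ k * sign_avg k Q y = (\<Sum>X\<in>?P. \<Sum>D'\<in>?P. (\<Prod>i\<in>X. sg D i) * (\<Prod>i\<in>X. sg D' i) * ?Q D')"
    by (simp add: sign_coeff_def sum_distrib_left mult.assoc)
  also have "\<dots> = (\<Sum>D'\<in>?P. (\<Sum>X\<in>?P. (\<Prod>i\<in>X. sg D i) * (\<Prod>i\<in>X. sg D' i)) * ?Q D')"
    unfolding sum_distrib_right by (rule sum.swap)
  also have "\<dots> = (\<Sum>D'\<in>?P. if D' = D then 2 ^ k * ?Q D else 0)"
    by (rule sum.cong) (auto simp: orth)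
  also have "\<dots> = 2 ^ k * ?Q D" using D by simp
  finally show ?thesis by simp
qed

context
  fixes k :: nat and Q :: "(nat \<Rightarrow> real) \<Rightarrow> real"
  assumes dep: "\<And>y y'. (\<And>i. i < k \<Longrightarrow> y i = y' i) \<Longrightarrow> Q y = Q y'"
    and hom: "\<And>c y. Q (\<lambda>i. c * y i) = \<bar>c\<bar> * Q y"
    and sub: "\<And>y y'. Q (\<lambda>i. y i + y' i) \<le> Q y + Q y'"
begin

lemma seminorm_nonneg: "0 \<le> Q y"
  using sub[of y "\<lambda>i. -1 * y i"] hom[of 0 y] hom[of "-1" y] by simp

lemma uncond_gauge_sign_avg: "uncond_gauge k (sign_avg k Q)"
  unfolding uncond_gauge_def
proof (intro conjI allI impI)
  fix y y' :: "nat \<Rightarrow> real" and c :: real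
  show "sign_avg k Q (\<lambda>i. c * y i) = \<bar>c\<bar> * sign_avg k Q y"
    using hom[of c] by (simp add: sign_avg_def sum_distrib_left mult.left_commute)
  show "sign_avg k Q (\<lambda>i. y i + y' i) \<le> sign_avg k Q y + sign_avg k Q y'"
    unfolding sign_avg_def add_divide_distrib[symmetric] sum.distrib[symmetric] distrib_left
    by (intro divide_right_mono sum_mono sub) simp
  assume abs: "\<forall>i<k. \<bar>y i\<bar> = \<bar>y' i\<bar>"
  define E where "E = {i. i < k \<and> y i \<noteq> y' i}"
  have y: "y i = sg E i * y' i" if "i < k" for i
    using abs that by (auto simp: E_def sg_def abs_eq_iff)
  have "(\<Sum>D\<in>Pow {..<k}. Q (\<lambda>i. sg D i * y i)) = (\<Sum>D\<in>Pow {..<k}. Q (\<lambda>i. sg (sym_diff D E) i * y' i))"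
    unfolding sg_sym_diff by (intro sum.cong refl dep) (simp add: y)
  also have "\<dots> = (\<Sum>D\<in>Pow {..<k}. Q (\<lambda>i. sg D i * y' i))"
    by (rule sum_sym_diff) (auto simp: E_def)
  finally show "sign_avg k Q y = sign_avg k Q y'" by (simp add: sign_avg_def)
qed

text \<open>Pair \<open>D\<close> with the sign vector that differs from it everywhere except at
  \<open>j\<close>: when the two signed vectors are added, the \<open>j\<close>-th coordinate
  doubles and all others cancel.\<close>

lemma sign_avg_ge_coordinate:
  assumes j: "j < k"
  shows "\<bar>y j\<bar> * Q (\<lambda>i. of_bool (i = j)) \<le> sign_avg k Q y"
proof -
  define E where "E = {..<k} - {j}"
  have "2 * (\<bar>y j\<bar> * Q (\<lambda>i. of_bool (i = j))) \<le> Q (\<lambda>i. sg D i * y i) + Q (\<lambda>i. sg (sym_diff D E) i * y i)" for D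
  proof -
    have "2 * (\<bar>y j\<bar> * Q (\<lambda>i. of_bool (i = j))) = Q (\<lambda>i. (2 * sg D j * y j) * of_bool (i = j))"
      unfolding hom by (simp add: abs_mult)
    also have "\<dots> = Q (\<lambda>i. sg D i * y i + sg (sym_diff D E) i * y i)"
      unfolding sg_sym_diff by (rule dep) (auto simp: E_def sg_def)
    also have "\<dots> \<le> Q (\<lambda>i. sg D i * y i) + Q (\<lambda>i. sg (sym_diff D E) i * y i)" by (rule sub)
    finally show ?thesis .
  qed
  then have "(\<Sum>D\<in>Pow {..<k}. 2 * (\<bar>y j\<bar> * Q (\<lambda>i. of_bool (i = j)))) \<le>
      (\<Sum>D\<in>Pow {..<k}. Q (\<lambda>i. sg D i * y i) + Q (\<lambda>i. sg (sym_diff D E) i * y i))"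
    by (intro sum_mono)
  also have "\<dots> = 2 * (\<Sum>D\<in>Pow {..<k}. Q (\<lambda>i. sg D i * y i))"
    using sum_sym_diff[of E "{..<k}" "\<lambda>D. Q (\<lambda>i. sg D i * y i)"] by (simp add: sum.distrib E_def)
  finally show ?thesis
    by (simp add: sign_avg_def card_Pow field_simps)
qed

text \<open>The sum behind the average contains \<open>Q y\<close> among nonnegative terms. The size
  of the constant is harmless, since \<open>net_approx\<close> removes it.\<close>

lemma le_sign_avg: "Q y \<le> 2 ^ k * sign_avg k Q y"
proof -
  have "Q (\<lambda>i. sg {} i * y i) \<le> (\<Sum>D\<in>Pow {..<k}. Q (\<lambda>i. sg D i * y i))"
    by (rule member_le_sum[where f = "\<lambda>D. Q (\<lambda>i. sg D i * y i)"]) (auto simp: seminorm_nonneg)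
  then show ?thesis by (simp add: sign_avg_def)
qed

end

section \<open>Approximation from a net\<close>

text \<open>Only nonnegative points are collected; signs come from \<open>sg D\<close>. For
  \<open>T = k * N\<close> these are \<open>N\<close> times the points of the \<open>1 / N\<close>
  grid in \<open>k\<close> times the cross-polytope.\<close>

definition lattice_simplex :: "nat \<Rightarrow> nat \<Rightarrow> (nat \<Rightarrow> nat) set" where
  "lattice_simplex k T = {m \<in> {..<k} \<rightarrow>\<^sub>E {..T}. (\<Sum>i<k. m i) \<le> T}"

lemma finite_lattice_simplex: "finite (lattice_simplex k T)"
  unfolding lattice_simplex_def by (rule finite_subset[OF _ finite_PiE[of "{..<k}" "\<lambda>_. {..T}"]]) auto

text \<open>Weight the lattice point \<open>m\<close> by \<open>\<theta>\<close> to the power \<open>\<Sum>m\<close>, where \<open>\<theta> = N / (N + 1)\<close>.\<close>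
lemma card_lattice_simplex:
  assumes N: "0 < N"
  shows "real (card (lattice_simplex k (k * N))) \<le> (3 * (real N + 1)) ^ k"
proof -
  define \<theta> where "\<theta> = real N / (real N + 1)"
  have \<theta>: "0 < \<theta>" "\<theta> < 1" "1 / \<theta> = 1 + 1 / real N" "1 - \<theta> = 1 / (real N + 1)"
    using N by (auto simp: \<theta>_def field_simps)
  let ?P = "{..<k} \<rightarrow>\<^sub>E {..k * N}"
  have "real (card (lattice_simplex k (k * N))) * \<theta> ^ (k * N) = (\<Sum>m\<in>lattice_simplex k (k * N). \<theta> ^ (k * N))"
    by simp
  also have "\<dots> \<le> (\<Sum>m\<in>lattice_simplex k (k * N). \<Prod>i<k. \<theta> ^ m i)"
    using \<theta> by (intro sum_mono) (auto simp: lattice_simplex_def power_sum[symmetric] intro!: power_decreasing)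
  also have "\<dots> \<le> (\<Sum>m\<in>?P. \<Prod>i<k. \<theta> ^ m i)"
  proof (rule sum_mono2)
    show "lattice_simplex k (k * N) \<subseteq> ?P" unfolding lattice_simplex_def by blast
    show "0 \<le> (\<Prod>i<k. \<theta> ^ m i)" for m using \<theta> by (intro prod_nonneg) simp
  qed (simp add: finite_PiE)
  also have "\<dots> = (\<Prod>i<k. \<Sum>t\<le>k * N. \<theta> ^ t)"
    by (rule prod_sum_PiE[symmetric]) auto
  also have "\<dots> \<le> (\<Prod>i<k. real N + 1)"
  proof (rule prod_mono, rule conjI)
    show "0 \<le> (\<Sum>t\<le>k * N. \<theta> ^ t)" using \<theta> by (intro sum_nonneg) auto
    have "(\<Sum>t\<le>k * N. \<theta> ^ t) \<le> suminf (\<lambda>t. \<theta> ^ t)"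
      using \<theta> by (intro sum_le_suminf) (auto intro: summable_geometric)
    also have "\<dots> = real N + 1" using \<theta> by (subst suminf_geometric) auto
    finally show "(\<Sum>t\<le>k * N. \<theta> ^ t) \<le> real N + 1" .
  qed
  finally have 1: "real (card (lattice_simplex k (k * N))) * \<theta> ^ (k * N) \<le> (real N + 1) ^ k" by simp
  \<comment> \<open>Undoing the weight costs \<open>(1 + 1 / N) ^ N \<le> exp 1 \<le> 3\<close> per
    coordinate, so the base of the bound is free of \<open>k\<close>.\<close>
  have "(1 / \<theta>) ^ (k * N) = ((1 + 1 / real N) ^ N) ^ k"
    unfolding \<theta> by (simp add: power_mult mult.commute flip: power_mult)
  also have "\<dots> \<le> 3 ^ k"
  proof (rule power_mono)
    have "(1 + 1 / real N) ^ N \<le> exp (1 / real N) ^ N"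
      by (intro power_mono exp_ge_add_one_self) auto
    also have "\<dots> = exp 1" using N by (simp flip: exp_of_nat_mult)
    also have "\<dots> \<le> 3" by (rule exp_le)
    finally show "(1 + 1 / real N) ^ N \<le> 3" .
  qed auto
  finally have 2: "(1 / \<theta>) ^ (k * N) \<le> 3 ^ k" .
  have "real (card (lattice_simplex k (k * N))) =
      real (card (lattice_simplex k (k * N))) * \<theta> ^ (k * N) * (1 / \<theta>) ^ (k * N)"
    using \<theta>(1) by (simp add: power_divide)
  also have "\<dots> \<le> (real N + 1) ^ k * 3 ^ k"
    using 1 2 \<theta>(1) by (intro mult_mono) auto
  also have "\<dots> = (3 * (real N + 1)) ^ k" by (simp only: power_mult_distrib mult.commute)
  finally show ?thesis .
qed

context
  fixes k N :: nat and Q q :: "(nat \<Rightarrow> real) \<Rightarrow> real"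
  assumes dep: "\<And>y y'. (\<And>i. i < k \<Longrightarrow> y i = y' i) \<Longrightarrow> Q y = Q y'"
    and hom: "\<And>c y. Q (\<lambda>i. c * y i) = \<bar>c\<bar> * Q y"
    and sub: "\<And>y y'. Q (\<lambda>i. y i + y' i) \<le> Q y + Q y'"
    and q: "uncond_gauge k q"
    and q_ones: "q (\<lambda>i. 1) \<le> 1"
    and q_low: "\<And>y. (\<Sum>i<k. \<bar>y i\<bar>) \<le> k * q y"
    and N: "0 < N"
    and net: "\<And>m D. m \<in> lattice_simplex k (k * N) \<Longrightarrow> D \<subseteq> {..<k} \<Longrightarrow>
      Q (\<lambda>i. sg D i * real (m i)) = q (\<lambda>i. real (m i))"
begin

text \<open>Round \<open>y\<close> towards 0 to \<open>c\<close> times a signed lattice point, where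
  \<open>Q\<close> and \<open>q\<close> agree. The error is at most \<open>c\<close> in
  \<open>q\<close> by \<open>q_ones\<close>, hence at most \<open>B * c\<close> in \<open>Q\<close>;
  rounding towards 0 ensures \<open>q y' \<le> q y\<close>, so the upper bound carries only the term
  \<open>B / N\<close>.\<close>

lemma net_step:
  assumes B: "\<And>y. Q y \<le> B * q y" and B0: "0 \<le> B"
  shows "Q y \<le> (1 + B / N) * q y" and "(1 - 1 / N - B / N) * q y \<le> Q y"
proof -
  have "Q y \<le> (1 + B / N) * q y \<and> (1 - 1 / N - B / N) * q y \<le> Q y"
  proof (cases "q y = 0")
    case True
    have "(\<Sum>i<k. \<bar>y i\<bar>) \<le> 0" using q_low[of y] True by simp
    moreover have "0 \<le> (\<Sum>i<k. \<bar>y i\<bar>)" by (rule sum_nonneg) simp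
    ultimately have "(\<Sum>i<k. \<bar>y i\<bar>) = 0" by simp
    then have "y i = 0" if "i < k" for i using that sum_nonneg_eq_0_iff[of "{..<k}" "\<lambda>i. \<bar>y i\<bar>"] by simp
    then have "Q y = Q (\<lambda>i. 0 * y i)" by (intro dep) simp
    then show ?thesis using True hom[of 0 y] by simp
  next
    case False
    then have qy: "0 < q y" using gauge_nonneg[OF q, of y] by simp
    \<comment> \<open>At this scale \<open>q_low\<close> bounds the coordinate sum of the rounded
      vector by \<open>k * N\<close>.\<close>
    define c where "c = q y / N"
    have c: "0 < c" using qy N by (simp add: c_def)
    define z where "z i = \<bar>y i\<bar> / c" for i
    define m where "m = (\<lambda>i\<in>{..<k}. nat \<lfloor>z i\<rfloor>)"
    define D where "D = {i. i < k \<and> y i < 0}"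
    define y' where "y' i = c * (sg D i * real (m i))" for i
    have z0: "0 \<le> z i" for i using c by (simp add: z_def)
    have m: "real (m i) \<le> z i" "z i - real (m i) \<le> 1" if "i < k" for i
      using that z0[of i] by (simp_all add: m_def) linarith+
    have yz: "y i = c * (sg D i * z i)" if "i < k" for i
      using that c by (auto simp: z_def sg_def D_def)
    have sum_m: "(\<Sum>i<k. m i) \<le> k * N"
    proof -
      have "real (\<Sum>i<k. m i) \<le> (\<Sum>i<k. z i)" unfolding of_nat_sum by (intro sum_mono m) auto
      also have "\<dots> = (\<Sum>i<k. \<bar>y i\<bar>) / c" by (simp add: z_def sum_divide_distrib)
      also have "\<dots> \<le> k * q y / c" using q_low[of y] c by (intro divide_right_mono) auto
      also have "\<dots> = real (k * N)" using qy by (simp add: c_def)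
      finally show ?thesis by (simp only: of_nat_le_iff)
    qed
    have "m i \<le> k * N" if "i < k" for i
      using member_le_sum[of i "{..<k}" m] that sum_m by simp
    then have "m \<in> lattice_simplex k (k * N)"
      using sum_m by (auto simp: lattice_simplex_def m_def)
    then have "Q (\<lambda>i. sg D i * real (m i)) = q (\<lambda>i. real (m i))"
      by (rule net) (auto simp: D_def)
    moreover have "q (\<lambda>i. real (m i)) = q (\<lambda>i. sg D i * real (m i))"
      by (rule gauge_cong[OF q]) (simp add: abs_mult)
    ultimately have Qy': "Q y' = q y'"
      unfolding y'_def by (simp only: hom gauge_scale[OF q])
    have diff: "\<bar>y i - y' i\<bar> \<le> c" if "i < k" for i
    proof -
      have "y i - y' i = c * (sg D i * (z i - real (m i)))"
        using yz[OF that] by (simp add: y'_def algebra_simps)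
      then have "\<bar>y i - y' i\<bar> = c * \<bar>z i - real (m i)\<bar>" using c by (simp add: abs_mult)
      also have "\<dots> \<le> c * 1" using m[OF that] c by (intro mult_left_mono) auto
      finally show ?thesis by simp
    qed
    have "q (\<lambda>i. y i - y' i) \<le> q (\<lambda>i. c * 1)"
      using diff c by (intro gauge_mono[OF q]) auto
    also have "\<dots> \<le> c" unfolding gauge_scale[OF q] using q_ones c by (simp add: mult_left_le)
    finally have qd: "q (\<lambda>i. y i - y' i) \<le> c" .
    have swap: "q (\<lambda>i. y' i - y i) = q (\<lambda>i. y i - y' i)"
      by (rule gauge_cong[OF q]) (simp add: abs_minus_commute)
    have Qd: "Q (\<lambda>i. y i - y' i) \<le> B * c" "Q (\<lambda>i. y' i - y i) \<le> B * c"
      using B[of "\<lambda>i. y i - y' i"] B[of "\<lambda>i. y' i - y i"] mult_left_mono[OF qd B0]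
      unfolding swap by linarith+
    have "q y' \<le> q y"
    proof (rule gauge_mono[OF q])
      fix i assume i: "i < k"
      have "\<bar>y' i\<bar> = c * real (m i)" using c by (simp add: y'_def abs_mult)
      also have "\<dots> \<le> c * z i" using m[OF i] c by simp
      also have "\<dots> = \<bar>y i\<bar>" using c by (simp add: z_def)
      finally show "\<bar>y' i\<bar> \<le> \<bar>y i\<bar>" .
    qed
    moreover have "q y - c \<le> q y'" using gauge_diff[OF q, of y y'] qd by linarith
    moreover have "Q y \<le> Q y' + Q (\<lambda>i. y i - y' i)" using sub[of y' "\<lambda>i. y i - y' i"] by simp
    moreover have "Q y' \<le> Q y + Q (\<lambda>i. y' i - y i)" using sub[of y "\<lambda>i. y' i - y i"] by simp
    ultimately have "Q y \<le> q y + B * c" "q y - c - B * c \<le> Q y"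
      using Qy' Qd by linarith+
    then show ?thesis by (simp add: c_def algebra_simps)
  qed
  then show "Q y \<le> (1 + B / N) * q y" and "(1 - 1 / N - B / N) * q y \<le> Q y" by auto
qed

text \<open>Iterating \<open>net_step\<close> makes the initial bound \<open>B\<close> disappear,
  however large, and leaves \<open>L \<le> 1 + \<epsilon>\<close>; one more application with
  \<open>B = L\<close> gives the lower bound.\<close>

lemma net_approx:
  assumes B: "\<And>y. Q y \<le> B * q y" and B0: "0 \<le> B"
    and \<epsilon>: "0 < \<epsilon>" "\<epsilon> < 1 / 2" "3 / \<epsilon> \<le> N"
  shows "Q y \<le> (1 + \<epsilon>) * q y" and "(1 - \<epsilon>) * q y \<le> Q y"
proof -
  define \<eta> where "\<eta> = 1 / real N"
  have \<eta>: "0 < \<eta>" "\<eta> \<le> \<epsilon> / 3" using N \<epsilon> by (auto simp: \<eta>_def field_simps)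
  define L where "L = 1 / (1 - \<eta>)"
  have L: "1 + L * \<eta> = L" "0 \<le> L" using \<eta> \<epsilon> by (auto simp: L_def field_simps)
  have L\<epsilon>: "L \<le> 1 + \<epsilon>"
  proof -
    have "\<eta> * (1 + \<epsilon>) \<le> \<epsilon> / 3 * 2" using \<eta> \<epsilon> by (intro mult_mono) auto
    then have "1 \<le> (1 + \<epsilon>) * (1 - \<eta>)" using \<epsilon> by (simp add: algebra_simps)
    then show ?thesis using \<eta> \<epsilon> by (simp add: L_def field_simps)
  qed
  \<comment> \<open>\<open>L\<close> is the fixed point of the improvement \<open>B \<mapsto> 1 + \<eta> B\<close> provided by \<open>net_step\<close>.\<close>
  have "Q y \<le> (L + B * \<eta> ^ j) * q y" for y j
  proof (induction j arbitrary: y)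
    case 0
    have "B * q y \<le> (L + B) * q y" using L gauge_nonneg[OF q, of y] by (intro mult_right_mono) auto
    then show ?case using B[of y] by simp
  next
    case (Suc j)
    have "0 \<le> L + B * \<eta> ^ j" using L B0 \<eta> by simp
    from net_step(1)[OF Suc.IH this, of y]
    have "Q y \<le> (1 + (L + B * \<eta> ^ j) * \<eta>) * q y" by (simp add: \<eta>_def)
    also have "1 + (L + B * \<eta> ^ j) * \<eta> = L + B * \<eta> ^ Suc j"
      using L(1) by (simp add: algebra_simps)
    finally show ?case .
  qed
  moreover have "(\<lambda>j. (L + B * \<eta> ^ j) * q y) \<longlonglongrightarrow> (L + B * 0) * q y" for y
    using \<eta> \<epsilon> by (intro tendsto_intros LIMSEQ_power_zero) auto
  ultimately have QL: "Q y \<le> L * q y" for y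
    using LIMSEQ_le_const[of "\<lambda>j. (L + B * \<eta> ^ j) * q y" "L * q y" "Q y"] by simp
  show "Q y \<le> (1 + \<epsilon>) * q y"
    using QL[of y] mult_right_mono[OF L\<epsilon> gauge_nonneg[OF q, of y]] by linarith
  \<comment> \<open>\<open>\<eta> \<le> \<epsilon> / 3\<close> and
    \<open>L * \<eta> \<le> 2 * (\<epsilon> / 3)\<close> add up to \<open>\<epsilon>\<close>; hence
    the 3 in the condition on \<open>N\<close>.\<close>
  have "L * \<eta> \<le> 2 * (\<epsilon> / 3)" using L\<epsilon> \<epsilon> \<eta> by (intro mult_mono) auto
  moreover have "1 / real N = \<eta>" "L / real N = L * \<eta>" by (simp_all add: \<eta>_def)
  ultimately have "1 - \<epsilon> \<le> 1 - 1 / N - L / N" using \<eta> by linarith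
  from mult_right_mono[OF this gauge_nonneg[OF q, of y]] net_step(2)[OF QL L(2), of y]
  show "(1 - \<epsilon>) * q y \<le> Q y" by linarith
qed

end

section \<open>Unconditional norms on spans of orthogonal vectors\<close>

lemma inner_Rn_sum: "inner_Rn n (\<Sum>i\<in>A. f i) y = (\<Sum>i\<in>A. inner_Rn n (f i) y)"
  unfolding inner_Rn_def lookup_sum sum_distrib_right by (rule sum.swap)

lemma inner_Rn_scaleR: "inner_Rn n (c *\<^sub>R x) y = c * inner_Rn n x y"
  "inner_Rn n x (c *\<^sub>R y) = c * inner_Rn n x y"
  by (simp_all add: inner_Rn_def lookup_scaleR sum_distrib_left mult_ac)

lemma inner_Rn_add: "inner_Rn n (x + x') y = inner_Rn n x y + inner_Rn n x' y"
  by (simp add: inner_Rn_def lookup_add distrib_right sum.distrib)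

lemma inner_Rn_self_pos:
  assumes "x \<in> Rn n" "x \<noteq> 0"
  shows "0 < inner_Rn n x x"
proof -
  obtain i where i: "Poly_Mapping.lookup x i \<noteq> 0"
    using assms(2) by (metis lookup_zero poly_mapping_eqI)
  then have "i < n" using assms(1) by (auto simp: Rn_def not_less[symmetric])
  then show ?thesis
    unfolding inner_Rn_def using i
    by (intro sum_pos2[of _ i]) (auto simp: zero_less_mult_iff)
qed

text \<open>Coordinates with respect to the orthogonal \<open>u i\<close> carry \<open>q\<close>
  over to the span. Normalising the \<open>u i\<close> only rescales these coordinates, so sign
  invariance persists for the orthonormal basis.\<close>

lemma unconditional_norm_of_gauge:
  fixes u :: "nat \<Rightarrow> rvec"
  assumes u: "\<And>i. i < k \<Longrightarrow> u i \<in> Rn n" "\<And>i. i < k \<Longrightarrow> u i \<noteq> 0"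
    and orth: "\<And>i j. i < k \<Longrightarrow> j < k \<Longrightarrow> i \<noteq> j \<Longrightarrow> inner_Rn n (u i) (u j) = 0"
    and q: "uncond_gauge k q" and def: "\<And>y i. q y = 0 \<Longrightarrow> i < k \<Longrightarrow> y i = 0"
  obtains E r where "E \<subseteq> Rn n" "subspace E" "dim E = k" "unconditional_norm_on n E r"
    "\<And>x. x \<in> E \<Longrightarrow> \<exists>y. x = (\<Sum>i<k. y i *\<^sub>R u i) \<and> r x = q y"
proof -
  define E where "E = span (u ` {..<k})"
  define a where "a i = inner_Rn n (u i) (u i)" for i
  have a: "0 < a i" if "i < k" for i unfolding a_def by (rule inner_Rn_self_pos) (use u that in auto)
  \<comment> \<open>Reading the coordinates off by inner products makes \<open>co\<close> linear, so
    homogeneity and subadditivity of \<open>r\<close> come directly from \<open>q\<close>.\<close>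
  define co where "co x i = inner_Rn n x (u i) / a i" for x i
  define r where "r x = q (co x)" for x
  have co_lin: "co (\<Sum>i<k. y i *\<^sub>R u i) j = y j" if "j < k" for y j
  proof -
    have "inner_Rn n (\<Sum>i<k. y i *\<^sub>R u i) (u j) = (\<Sum>i<k. if i = j then y j * a j else 0)"
      unfolding inner_Rn_sum inner_Rn_scaleR
      by (rule sum.cong) (use orth that in \<open>auto simp: a_def\<close>)
    then show ?thesis using that a[OF that] by (simp add: co_def)
  qed
  have inj: "inj_on u {..<k}"
  proof (rule inj_onI, rule ccontr)
    fix i j assume ij: "i \<in> {..<k}" "j \<in> {..<k}" "u i = u j" "i \<noteq> j"
    then have "a i = 0" using orth[of i j] by (simp add: a_def)
    then show False using a[of i] ij by simp
  qed
  have expand: "\<exists>y. x = (\<Sum>i<k. y i *\<^sub>R u i)" if "x \<in> E" for x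
  proof -
    obtain g where "x = (\<Sum>v\<in>u ` {..<k}. g v *\<^sub>R v)"
      using \<open>x \<in> E\<close> unfolding E_def by (auto simp: span_finite)
    then have "x = (\<Sum>i<k. g (u i) *\<^sub>R u i)" by (simp add: sum.reindex[OF inj])
    then show ?thesis by (rule exI[of _ "\<lambda>i. g (u i)"])
  qed
  have lin_E: "(\<Sum>i<k. y i *\<^sub>R u i) \<in> E" for y
    unfolding E_def by (intro span_sum span_scale span_base) auto
  have rep: "\<exists>y. x = (\<Sum>i<k. y i *\<^sub>R u i) \<and> r x = q y" if x: "x \<in> E" for x
  proof -
    obtain y where y: "x = (\<Sum>i<k. y i *\<^sub>R u i)" using expand[OF x] by blast
    have "r x = q y" unfolding r_def y by (rule gauge_cong[OF q]) (simp add: co_lin)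
    then show ?thesis using y by blast
  qed
  have sub: "subspace E" unfolding E_def by (rule subspace_span)
  have "independent (u ` {..<k})"
    unfolding independent_explicit_finite_subsets
  proof (intro allI impI ballI)
    fix S g v assume S: "S \<subseteq> u ` {..<k}" "finite S" and 0: "(\<Sum>v\<in>S. g v *\<^sub>R v) = 0" and v: "v \<in> S"
    obtain j where j: "j < k" "v = u j" using S v by auto
    have "0 = inner_Rn n (\<Sum>v\<in>S. g v *\<^sub>R v) (u j)" by (simp add: 0 inner_Rn_def)
    also have "\<dots> = (\<Sum>w\<in>S. if w = v then g v * a j else 0)"
      unfolding inner_Rn_sum inner_Rn_scaleR
    proof (rule sum.cong[OF refl])
      fix w assume "w \<in> S"
      then obtain i where "i < k" "w = u i" using S by auto
      then show "g w * inner_Rn n w (u j) = (if w = v then g v * a j else 0)"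
        using j orth[of i j] by (auto simp: a_def)
    qed
    also have "\<dots> = g v * a j" using S v by simp
    finally show "g v = 0" using a[OF j(1)] by simp
  qed
  then have dim: "dim E = k"
    unfolding E_def by (simp add: dim_span dim_eq_card_independent card_image inj)
  have E_Rn: "E \<subseteq> Rn n"
    unfolding E_def using u subspace_Rn by (intro span_minimal) auto
  have "norm_on E r"
    unfolding norm_on_def
  proof (intro conjI ballI allI)
    fix x assume x: "x \<in> E"
    show "0 \<le> r x" unfolding r_def by (rule gauge_nonneg[OF q])
    obtain y where y: "x = (\<Sum>i<k. y i *\<^sub>R u i)" "r x = q y" using rep[OF x] by blast
    show "r x = 0 \<longleftrightarrow> x = 0"
    proof
      assume "r x = 0"
      then have "y i = 0" if "i < k" for i using def[of y i] that y(2) by simp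
      then show "x = 0" using y(1) by simp
    next
      assume "x = 0"
      then show "r x = 0" by (simp add: r_def co_def inner_Rn_def gauge_zero[OF q])
    qed
    show "r (c *\<^sub>R x) = \<bar>c\<bar> * r x" for c
      by (simp add: r_def co_def[abs_def] inner_Rn_scaleR gauge_scale[OF q] flip: times_divide_eq_right)
    show "r (x + x') \<le> r x + r x'" for x'
      using gauge_add[OF q, of "co x" "co x'"]
      by (simp add: r_def co_def[abs_def] inner_Rn_add add_divide_distrib)
  qed
  moreover have "orthonormal_basis n E k (\<lambda>i. (1 / sqrt (a i)) *\<^sub>R u i)"
    unfolding orthonormal_basis_def
  proof (intro conjI allI impI)
    fix i assume i: "i < k"
    show "(1 / sqrt (a i)) *\<^sub>R u i \<in> E" unfolding E_def using i by (intro span_scale span_base) auto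
    fix j assume j: "j < k"
    show "inner_Rn n ((1 / sqrt (a i)) *\<^sub>R u i) ((1 / sqrt (a j)) *\<^sub>R u j) = (if i = j then 1 else 0)"
      using orth[OF i j] a[OF i] by (auto simp: inner_Rn_scaleR field_simps simp flip: a_def)
  next
    have "span ((\<lambda>v. (1 / sqrt (inner_Rn n v v)) *\<^sub>R v) ` u ` {..<k}) = span (u ` {..<k})"
    proof (rule span_image_scale)
      fix v assume "v \<in> u ` {..<k}"
      then obtain i where "i < k" "v = u i" by auto
      then show "1 / sqrt (inner_Rn n v v) \<noteq> 0" using a[of i] by (simp add: a_def)
    qed simp
    then show "span ((\<lambda>i. (1 / sqrt (a i)) *\<^sub>R u i) ` {..<k}) = E"
      by (simp add: image_image a_def E_def)
  qed
  moreover have "r (\<Sum>i<k. (\<delta> i * x i) *\<^sub>R ((1 / sqrt (a i)) *\<^sub>R u i)) = r (\<Sum>i<k. x i *\<^sub>R ((1 / sqrt (a i)) *\<^sub>R u i))"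
    if \<delta>: "\<forall>i<k. \<delta> i \<in> {1, -1}" for x \<delta> :: "nat \<Rightarrow> real"
  proof -
    have r_lin: "r (\<Sum>i<k. y i *\<^sub>R ((1 / sqrt (a i)) *\<^sub>R u i)) = q (\<lambda>i. y i * (1 / sqrt (a i)))" for y
      unfolding r_def scaleR_scaleR by (rule gauge_cong[OF q]) (simp add: co_lin)
    have "\<bar>\<delta> i * x i * (1 / sqrt (a i))\<bar> = \<bar>x i * (1 / sqrt (a i))\<bar>" if "i < k" for i
      using \<delta> that by (auto simp: abs_mult)
    then show ?thesis unfolding r_lin by (intro gauge_cong[OF q])
  qed
  ultimately have "unconditional_norm_on n E r"
    unfolding unconditional_norm_on_def dim by blast
  then show ?thesis using that[OF E_Rn sub dim] rep by blast
qed

section \<open>Nearly unconditional subspaces\<close>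

lemma norm_on_sum_le:
  assumes p: "norm_on V p" and V: "subspace V" and f: "\<And>i. i \<in> A \<Longrightarrow> f i \<in> V"
  shows "p (\<Sum>i\<in>A. f i) \<le> (\<Sum>i\<in>A. p (f i))"
proof -
  have p0: "p 0 = 0" using p subspace_0[OF V] unfolding norm_on_def by blast
  show ?thesis using f
  proof (induction A rule: infinite_finite_induct)
    case (insert a A)
    have "f a \<in> V" "(\<Sum>i\<in>A. f i) \<in> V" using insert.prems V by (auto intro!: subspace_sum)
    then have "p (f a + (\<Sum>i\<in>A. f i)) \<le> p (f a) + p (\<Sum>i\<in>A. f i)"
      using p unfolding norm_on_def by blast
    then show ?case using insert by simp
  qed (simp_all add: p0)
qed

lemma Rn_expand:
  assumes "x \<in> Rn n"
  shows "x = (\<Sum>r<n. Poly_Mapping.lookup x r *\<^sub>R Poly_Mapping.single r (1::real))"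
proof (rule poly_mapping_eqI)
  fix j
  have "Poly_Mapping.lookup (\<Sum>r<n. Poly_Mapping.lookup x r *\<^sub>R Poly_Mapping.single r (1::real)) j =
      (\<Sum>r<n. if r = j then Poly_Mapping.lookup x j else 0)"
    unfolding lookup_sum lookup_scaleR by (rule sum.cong) (auto simp: lookup_single when_def)
  also have "\<dots> = Poly_Mapping.lookup x j" using assms by (auto simp: Rn_def)
  finally show "Poly_Mapping.lookup x j =
      Poly_Mapping.lookup (\<Sum>r<n. Poly_Mapping.lookup x r *\<^sub>R Poly_Mapping.single r (1::real)) j" by simp
qed

lemma single_Rn: "r < n \<Longrightarrow> Poly_Mapping.single r (c::real) \<in> Rn n"
  by (auto simp: Rn_def lookup_single when_def)

lemma norm_on_Rn_le:
  assumes p: "norm_on (Rn n) p" and x: "x \<in> Rn n"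
  shows "p x \<le> (\<Sum>r<n. \<bar>Poly_Mapping.lookup x r\<bar> * p (Poly_Mapping.single r 1))"
proof -
  have "p x \<le> (\<Sum>r<n. p (Poly_Mapping.lookup x r *\<^sub>R Poly_Mapping.single r 1))"
    by (subst Rn_expand[OF x], rule norm_on_sum_le[OF p subspace_Rn])
       (auto intro!: subspace_scale[OF subspace_Rn] single_Rn)
  also have "\<dots> = (\<Sum>r<n. \<bar>Poly_Mapping.lookup x r\<bar> * p (Poly_Mapping.single r 1))"
    using p by (intro sum.cong) (auto simp: norm_on_def single_Rn)
  finally show ?thesis .
qed

lemma norm_on_diff_le:
  assumes p: "norm_on V p" and V: "subspace V" and xy: "x \<in> V" "y \<in> V"
  shows "\<bar>p x - p y\<bar> \<le> p (x - y)"
proof -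
  have add: "p (a + b) \<le> p a + p b" if "a \<in> V" "b \<in> V" for a b
    using p that by (auto simp: norm_on_def)
  have d: "x - y \<in> V" using V xy by (rule subspace_diff)
  have "p ((-1) *\<^sub>R (x - y)) = \<bar>-1\<bar> * p (x - y)" using p d unfolding norm_on_def by blast
  then have "p (y - x) = p (x - y)" by simp
  then show ?thesis
    using add[OF xy(2) d] add[OF xy(1), of "y - x"] subspace_diff[OF V xy(2,1)] by (simp add: abs_le_iff)
qed

text \<open>\<open>p\<close> is Lipschitz with respect to a weighted sum of coordinate differences,
  so coordinatewise continuity of \<open>g\<close> suffices.\<close>

lemma continuous_on_norm_on:
  assumes p: "norm_on (Rn n) p" and g: "\<And>x. x \<in> X \<Longrightarrow> g x \<in> Rn n"
    and c: "\<And>r. continuous_on X (\<lambda>x. Poly_Mapping.lookup (g x) r)"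
  shows "continuous_on X (\<lambda>x. p (g x))"
  unfolding continuous_on_def
proof
  fix x assume x: "x \<in> X"
  let ?F = "at x within X"
  define e where "e r = p (Poly_Mapping.single r 1)" for r
  have 1: "((\<lambda>y. Poly_Mapping.lookup (g y) r) \<longlongrightarrow> Poly_Mapping.lookup (g x) r) ?F" for r
    using c x unfolding continuous_on_def by blast
  have "((\<lambda>y. \<Sum>r<n. \<bar>Poly_Mapping.lookup (g y) r - Poly_Mapping.lookup (g x) r\<bar> * e r) \<longlongrightarrow>
      (\<Sum>r<n. \<bar>Poly_Mapping.lookup (g x) r - Poly_Mapping.lookup (g x) r\<bar> * e r)) ?F"
    by (intro tendsto_intros 1)
  then have lim: "((\<lambda>y. \<Sum>r<n. \<bar>Poly_Mapping.lookup (g y) r - Poly_Mapping.lookup (g x) r\<bar> * e r) \<longlongrightarrow> 0) ?F"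
    by simp
  have "\<bar>p (g y) - p (g x)\<bar> \<le> (\<Sum>r<n. \<bar>Poly_Mapping.lookup (g y) r - Poly_Mapping.lookup (g x) r\<bar> * e r)"
    if y: "y \<in> X" for y
    using norm_on_diff_le[OF p subspace_Rn g[OF y] g[OF x]]
      norm_on_Rn_le[OF p subspace_diff[OF subspace_Rn g[OF y] g[OF x]]]
    by (simp add: lookup_minus e_def)
  then have "\<forall>\<^sub>F y in ?F. norm (p (g y) - p (g x)) \<le>
      (\<Sum>r<n. \<bar>Poly_Mapping.lookup (g y) r - Poly_Mapping.lookup (g x) r\<bar> * e r)"
    by (auto simp: eventually_at_filter)
  from Lim_null_comparison[OF this lim] show "((\<lambda>y. p (g y)) \<longlongrightarrow> p (g x)) ?F"
    by (rule LIM_zero_cancel)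
qed

section \<open>Orthogonal blocks and their dependence on the parameter\<close>

text \<open>
  An odd parametrisation on the boundary: when some \<open>\<bar>x e\<bar>\<close> in block \<open>j\<close> is 1, the first summand vanishes.
  Different \<open>j\<close> use disjoint coordinates, so the vectors are orthogonal.
\<close>
definition block_vec :: "nat \<Rightarrow> (nat \<Rightarrow> nat) \<Rightarrow> (nat \<Rightarrow> real) \<Rightarrow> nat \<Rightarrow> rvec" where
  "block_vec M b x j = (\<Prod>e\<in>{e. e < M \<and> b e = j}. 1 - \<bar>x e\<bar>) *\<^sub>R Poly_Mapping.single (M + j) 1 +
     (\<Sum>e\<in>{e. e < M \<and> b e = j}. x e *\<^sub>R Poly_Mapping.single e 1)"

lemma lookup_block_vec:
  "Poly_Mapping.lookup (block_vec M b x j) r =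
     (if r = M + j then \<Prod>e\<in>{e. e < M \<and> b e = j}. 1 - \<bar>x e\<bar>
      else if r < M \<and> b r = j then x r else 0)"
proof -
  have "Poly_Mapping.lookup (\<Sum>e\<in>{e. e < M \<and> b e = j}. x e *\<^sub>R Poly_Mapping.single e (1::real)) r =
      (\<Sum>e\<in>{e. e < M \<and> b e = j}. if e = r then x r else 0)"
    unfolding lookup_sum lookup_scaleR by (rule sum.cong) (auto simp: lookup_single when_def)
  also have "\<dots> = (if r < M \<and> b r = j then x r else 0)" by simp
  finally show ?thesis
    by (auto simp: block_vec_def lookup_add lookup_scaleR lookup_single when_def)
qed

lemma block_vec_Rn: "j < k \<Longrightarrow> M + k \<le> n \<Longrightarrow> block_vec M b x j \<in> Rn n"
  by (auto simp: Rn_def lookup_block_vec)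

lemma block_vec_nonzero: "block_vec M b x j \<noteq> 0"
proof
  assume 0: "block_vec M b x j = 0"
  have "x e = 0" if "e < M" "b e = j" for e
    using lookup_block_vec[of M b x j e] that by (simp add: 0)
  then have "(\<Prod>e\<in>{e. e < M \<and> b e = j}. 1 - \<bar>x e\<bar>) = 1" by (intro prod.neutral) auto
  then show False using lookup_block_vec[of M b x j "M + j"] by (simp add: 0)
qed

lemma block_vec_flip:
  assumes r: "r < M" "\<bar>x r\<bar> = 1"
  shows "block_vec M b (flip b (b r) x) j = sg {b r} j *\<^sub>R block_vec M b x j"
proof (rule poly_mapping_eqI)
  fix i
  have "(\<Prod>e\<in>{e. e < M \<and> b e = b r}. 1 - \<bar>y e\<bar>) = 0" if "\<bar>y r\<bar> = 1" for y :: "nat \<Rightarrow> real"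
    using r(1) that by (intro prod_zero) auto
  from this[of x] this[of "flip b (b r) x"] r(2)
  show "Poly_Mapping.lookup (block_vec M b (flip b (b r) x) j) i =
      Poly_Mapping.lookup (sg {b r} j *\<^sub>R block_vec M b x j) i"
    unfolding lookup_block_vec lookup_scaleR
    by (cases "j = b r") (auto simp: sg_def flip_def intro!: prod.cong)
qed

lemma continuous_on_coordinate: "continuous_on X (\<lambda>x. x i)"
  by (rule continuous_on_subset[OF continuous_on_product_coordinates]) simp

lemma continuous_on_block_vec:
  "continuous_on X (\<lambda>x. Poly_Mapping.lookup (block_vec M b x j) r)"
proof (cases "r = M + j")
  case True
  then show ?thesis unfolding lookup_block_vec
    by (auto intro!: continuous_intros continuous_on_coordinate)
next
  case False
  then show ?thesis unfolding lookup_block_vec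
    by (cases "r < M"; cases "b r = j") (simp_all add: continuous_on_coordinate)
qed

lemma inner_block_vec: "i \<noteq> j \<Longrightarrow> inner_Rn n (block_vec M b x i) (block_vec M b x j) = 0"
  unfolding inner_Rn_def by (rule sum.neutral) (auto simp: lookup_block_vec)

definition unit_block :: "(rvec \<Rightarrow> real) \<Rightarrow> nat \<Rightarrow> (nat \<Rightarrow> nat) \<Rightarrow> (nat \<Rightarrow> real) \<Rightarrow> nat \<Rightarrow> rvec" where
  "unit_block p M b x j = (1 / p (block_vec M b x j)) *\<^sub>R block_vec M b x j"

definition comb_norm ::
    "(rvec \<Rightarrow> real) \<Rightarrow> nat \<Rightarrow> nat \<Rightarrow> (nat \<Rightarrow> nat) \<Rightarrow> (nat \<Rightarrow> real) \<Rightarrow> (nat \<Rightarrow> real) \<Rightarrow> real" where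
  "comb_norm p k M b x y = p (\<Sum>i<k. y i *\<^sub>R unit_block p M b x i)"

definition loz_scale :: "(rvec \<Rightarrow> real) \<Rightarrow> nat \<Rightarrow> nat \<Rightarrow> (nat \<Rightarrow> nat) \<Rightarrow> (nat \<Rightarrow> real) \<Rightarrow> nat \<Rightarrow> real" where
  "loz_scale p k M b x = (THE s. lozanovskii k (sign_avg k (comb_norm p k M b x)) s)"

context
  fixes n k M :: nat and b :: "nat \<Rightarrow> nat" and p :: "rvec \<Rightarrow> real"
  assumes p: "norm_on (Rn n) p" and dim: "M + k \<le> n" and k: "0 < k"
begin

lemma norm_block_pos: "j < k \<Longrightarrow> 0 < p (block_vec M b x j)"
proof -
  assume "j < k"
  then have "block_vec M b x j \<in> Rn n" using dim by (rule block_vec_Rn)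
  then have "0 \<le> p (block_vec M b x j)" "p (block_vec M b x j) \<noteq> 0"
    using p block_vec_nonzero[of M b x j] unfolding norm_on_def by blast+
  then show ?thesis by simp
qed

lemma norm_scale_Rn: "v \<in> Rn n \<Longrightarrow> p (c *\<^sub>R v) = \<bar>c\<bar> * p v"
  using p unfolding norm_on_def by blast

lemma unit_block_Rn: "j < k \<Longrightarrow> unit_block p M b x j \<in> Rn n"
  unfolding unit_block_def using block_vec_Rn dim by (intro subspace_scale[OF subspace_Rn]) blast

lemma norm_unit_block: "j < k \<Longrightarrow> p (unit_block p M b x j) = 1"
  using norm_block_pos[of j x] block_vec_Rn[of j k M n b x] dim by (simp add: unit_block_def norm_scale_Rn)

lemma comb_Rn: "(\<Sum>i<k. y i *\<^sub>R unit_block p M b x i) \<in> Rn n"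
  by (intro subspace_sum[OF subspace_Rn] subspace_scale[OF subspace_Rn] unit_block_Rn) simp

lemma comb_norm_dep: "(\<And>i. i < k \<Longrightarrow> y i = y' i) \<Longrightarrow> comb_norm p k M b x y = comb_norm p k M b x y'"
  unfolding comb_norm_def by (intro arg_cong[where f = p] sum.cong) auto

lemma comb_norm_hom: "comb_norm p k M b x (\<lambda>i. c * y i) = \<bar>c\<bar> * comb_norm p k M b x y"
  unfolding comb_norm_def using norm_scale_Rn[OF comb_Rn, of c y x] by (simp add: scaleR_sum_right)

lemma comb_norm_sub:
  "comb_norm p k M b x (\<lambda>i. y i + y' i) \<le> comb_norm p k M b x y + comb_norm p k M b x y'"
proof -
  have "p (v + w) \<le> p v + p w" if "v \<in> Rn n" "w \<in> Rn n" for v w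
    using p that unfolding norm_on_def by blast
  from this[OF comb_Rn comb_Rn] show ?thesis
    unfolding comb_norm_def scaleR_add_left sum.distrib .
qed

lemma comb_norm_unit:
  assumes "j < k"
  shows "comb_norm p k M b x (\<lambda>i. of_bool (i = j)) = 1"
proof -
  have "(\<Sum>i<k. of_bool (i = j) *\<^sub>R unit_block p M b x i) = (\<Sum>i<k. if i = j then unit_block p M b x j else 0)"
    by (rule sum.cong) auto
  also have "\<dots> = unit_block p M b x j" using assms by simp
  finally show ?thesis unfolding comb_norm_def using norm_unit_block[OF assms] by simp
qed

lemma comb_norm_flip:
  assumes "r < M" "\<bar>x r\<bar> = 1"
  shows "comb_norm p k M b (flip b (b r) x) y = comb_norm p k M b x (\<lambda>i. sg {b r} i * y i)"
proof -
  have "unit_block p M b (flip b (b r) x) j = sg {b r} j *\<^sub>R unit_block p M b x j" if "j < k" for j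
    using norm_scale_Rn[OF block_vec_Rn[OF that dim], of "sg {b r} j" b x]
    unfolding unit_block_def block_vec_flip[of r M x b j, OF assms] by simp
  then show ?thesis
    unfolding comb_norm_def by (intro arg_cong[where f = p] sum.cong) (auto simp: mult.commute)
qed

lemma gauge_comb: "uncond_gauge k (sign_avg k (comb_norm p k M b x))"
proof (rule uncond_gauge_sign_avg[where k = k and Q = "comb_norm p k M b x"])
  show "comb_norm p k M b x y = comb_norm p k M b x y'" if "\<And>i. i < k \<Longrightarrow> y i = y' i" for y y'
    using that by (rule comb_norm_dep)
  show "comb_norm p k M b x (\<lambda>i. c * y i) = \<bar>c\<bar> * comb_norm p k M b x y" for c y
    by (rule comb_norm_hom)
  show "comb_norm p k M b x (\<lambda>i. y i + y' i) \<le> comb_norm p k M b x y + comb_norm p k M b x y'" for y y'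
    by (rule comb_norm_sub)
qed

lemma gauge_comb_ge: "j < k \<Longrightarrow> \<bar>y j\<bar> \<le> sign_avg k (comb_norm p k M b x) y"
proof -
  assume j: "j < k"
  have "\<bar>y j\<bar> * comb_norm p k M b x (\<lambda>i. of_bool (i = j)) \<le> sign_avg k (comb_norm p k M b x) y"
  proof (rule sign_avg_ge_coordinate[where k = k and Q = "comb_norm p k M b x"])
    show "comb_norm p k M b x y = comb_norm p k M b x y'" if "\<And>i. i < k \<Longrightarrow> y i = y' i" for y y'
      using that by (rule comb_norm_dep)
    show "comb_norm p k M b x (\<lambda>i. c * y i) = \<bar>c\<bar> * comb_norm p k M b x y" for c y
      by (rule comb_norm_hom)
    show "comb_norm p k M b x (\<lambda>i. y i + y' i) \<le> comb_norm p k M b x y + comb_norm p k M b x y'" for y y'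
      by (rule comb_norm_sub)
    show "j < k" by (rule j)
  qed
  then show ?thesis by (simp add: comb_norm_unit[OF j])
qed

lemma gauge_comb_unit: "j < k \<Longrightarrow> sign_avg k (comb_norm p k M b x) (\<lambda>i. of_bool (i = j)) = 1"
proof -
  assume j: "j < k"
  have "comb_norm p k M b x (\<lambda>i. sg D i * of_bool (i = j)) = 1" for D
  proof -
    have "comb_norm p k M b x (\<lambda>i. sg D i * of_bool (i = j)) = comb_norm p k M b x (\<lambda>i. sg D j * of_bool (i = j))"
      by (rule comb_norm_dep) simp
    then show ?thesis unfolding comb_norm_hom using comb_norm_unit[OF j] by simp
  qed
  then show ?thesis by (simp add: sign_avg_def card_Pow)
qed

lemma loz_scale: "lozanovskii k (sign_avg k (comb_norm p k M b x)) (loz_scale p k M b x)"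
  unfolding loz_scale_def
proof (rule theI'[where P = "lozanovskii k (sign_avg k (comb_norm p k M b x))"])
  have "\<exists>s. lozanovskii k (sign_avg k (comb_norm p k M b x)) s"
    by (rule lozanovskii_exists[OF gauge_comb k]) (auto simp: gauge_comb_ge gauge_comb_unit)
  then show "\<exists>!s. lozanovskii k (sign_avg k (comb_norm p k M b x)) s"
    using lozanovskii_unique k by blast
qed

lemma loz_scale_eq:
  "lozanovskii k (sign_avg k (comb_norm p k M b x)) s \<Longrightarrow> loz_scale p k M b x = s"
  using lozanovskii_unique[OF loz_scale _ k] by blast

text \<open>A flip of \<open>x\<close> only permutes the sign changes that are averaged, so the
  averaged gauge and its unique scaling point stay the same.\<close>

lemma loz_scale_flip:
  assumes "r < M" "\<bar>x r\<bar> = 1" "b r < k"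
  shows "loz_scale p k M b (flip b (b r) x) = loz_scale p k M b x"
proof (rule loz_scale_eq)
  have eq: "comb_norm p k M b (flip b (b r) x) = (\<lambda>y. comb_norm p k M b x (\<lambda>i. sg {b r} i * y i))"
    using comb_norm_flip[of r x] assms by (simp add: fun_eq_iff)
  have "sign_avg k (comb_norm p k M b (flip b (b r) x)) = sign_avg k (comb_norm p k M b x)"
    unfolding eq by (rule ext, rule sign_avg_flip[OF assms(3)])
  then show "lozanovskii k (sign_avg k (comb_norm p k M b (flip b (b r) x))) (loz_scale p k M b x)"
    using loz_scale by simp
qed

text \<open>Parameter and coefficients vary together, because the rescaled test vectors depend on
  \<open>x\<close>.\<close>

lemma continuous_on_comb_norm:
  assumes A: "continuous_on X A" and B: "\<And>i. i < k \<Longrightarrow> continuous_on X (\<lambda>z. B z i)"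
  shows "continuous_on X (\<lambda>z. comb_norm p k M b (A z) (B z))"
  unfolding comb_norm_def
proof (rule continuous_on_norm_on[OF p comb_Rn])
  fix r
  have l: "continuous_on X (\<lambda>z. Poly_Mapping.lookup (block_vec M b (A z) i) r)" for i
    by (rule continuous_on_compose2[OF continuous_on_block_vec[of UNIV] A]) simp
  have "continuous_on UNIV (\<lambda>x. p (block_vec M b x i))" if "i < k" for i
    using block_vec_Rn[OF that dim] continuous_on_block_vec by (rule continuous_on_norm_on[OF p])
  then have pb: "continuous_on X (\<lambda>z. p (block_vec M b (A z) i))" if "i < k" for i
    using that by (intro continuous_on_compose2[OF _ A]) auto
  have "p (block_vec M b x i) \<noteq> 0" if "i < k" for i x using norm_block_pos[OF that, of x] by simp
  then show "continuous_on X (\<lambda>z. Poly_Mapping.lookup (\<Sum>i<k. B z i *\<^sub>R unit_block p M b (A z) i) r)"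
    unfolding lookup_sum lookup_scaleR unit_block_def
    by (intro continuous_intros B l pb) auto
qed

text \<open>A closed graph argument: the graph is compact, and its projection to the cube is a
  continuous bijection, so the inverse is continuous.\<close>

lemma continuous_on_loz_scale: "continuous_on (cube M) (loz_scale p k M b)"
proof -
  let ?q = "\<lambda>x. sign_avg k (comb_norm p k M b x)"
  \<comment> \<open>The lower bound \<open>1 / k\<close> keeps the denominators in
    \<open>lozanovskii\<close> away from 0 on the compact set \<open>K\<close>.\<close>
  define K where "K = {s. \<forall>r. s r \<in> (if r < k then {1 / real k..1} else {0::real})}"
  define C where "C = cube M \<times> K"
  have "compact K" unfolding K_def by (rule compact_fun_box) simp
  then have C: "compact C" unfolding C_def using compact_cube by (rule compact_Times[rotated])
  have cont_q: "continuous_on C (\<lambda>z. ?q (fst z) (B z))" if "\<And>i. i < k \<Longrightarrow> continuous_on C (\<lambda>z. B z i)" for B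
    unfolding sign_avg_def using that
    by (intro continuous_intros continuous_on_comb_norm) auto
  have cont_snd: "continuous_on C (\<lambda>z. snd z i)" for i
    by (rule continuous_on_compose2[OF continuous_on_coordinate[of UNIV i] continuous_on_snd[OF continuous_on_id]]) simp
  have snd_pos: "snd z i \<noteq> 0" if "z \<in> C" "i < k" for z i
  proof -
    have "1 / real k \<le> snd z i" using that by (auto simp: C_def K_def dest!: spec[of _ i])
    moreover have "0 < 1 / real k" using k by simp
    ultimately show ?thesis by linarith
  qed
  have cl: "closed {z \<in> C. f z \<le> g z}" if "continuous_on C f" "continuous_on C g" for f g :: "_ \<Rightarrow> real"
  proof -
    have "{z \<in> C. f z \<le> g z} = C \<inter> (\<lambda>z. f z - g z) -` {..0}" by auto
    also have "closed \<dots>"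
      using that C by (intro continuous_closed_preimage continuous_intros compact_imp_closed) auto
    finally show ?thesis .
  qed
  define G where "G = C \<inter> {z \<in> C. ?q (fst z) (snd z) \<le> 1} \<inter>
     (\<Inter>y. {z \<in> C. (\<Sum>i<k. \<bar>y i\<bar> / snd z i) \<le> k * ?q (fst z) y})"
  have "closed (\<Inter>y. {z \<in> C. (\<Sum>i<k. \<bar>y i\<bar> / snd z i) \<le> k * ?q (fst z) y})"
    by (intro closed_INT ballI cl continuous_intros cont_snd cont_q) (auto simp: snd_pos)
  moreover have "closed {z \<in> C. ?q (fst z) (snd z) \<le> 1}"
    by (intro cl continuous_intros cont_q cont_snd)
  ultimately have cG: "compact G"
    unfolding G_def using C by (intro compact_Int_closed)
  have G_iff: "z \<in> G \<longleftrightarrow> fst z \<in> cube M \<and> snd z = loz_scale p k M b (fst z)" for z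
  proof
    assume z: "z \<in> G"
    then have "\<forall>i<k. 1 / k \<le> snd z i \<and> snd z i \<le> 1" "\<forall>i\<ge>k. snd z i = 0"
      by (auto simp: G_def C_def K_def) (metis atLeastAtMost_iff, metis atLeastAtMost_iff, metis not_less singletonD)
    then have "lozanovskii k (?q (fst z)) (snd z)"
      using z unfolding lozanovskii_def by (auto simp: G_def)
    then show "fst z \<in> cube M \<and> snd z = loz_scale p k M b (fst z)"
      using loz_scale_eq z by (auto simp: G_def C_def)
  next
    assume z: "fst z \<in> cube M \<and> snd z = loz_scale p k M b (fst z)"
    then have l: "lozanovskii k (?q (fst z)) (snd z)" using loz_scale by simp
    then have "snd z \<in> K" by (auto simp: K_def lozanovskii_def)
    then have "z \<in> C" using z by (auto simp: C_def mem_Times_iff)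
    then show "z \<in> G" using l by (auto simp: G_def lozanovskii_def)
  qed
  have "continuous_on (fst ` G) (\<lambda>x. (x, loz_scale p k M b x))"
  proof (rule continuous_on_inv[OF _ cG])
    show "continuous_on G fst" by (rule continuous_on_fst[OF continuous_on_id])
  qed (auto simp: G_iff prod_eq_iff)
  moreover have "fst ` G = cube M"
    using G_iff by (force simp: image_iff)
  ultimately have "continuous_on (cube M) (\<lambda>x. snd (x, loz_scale p k M b x))"
    by (intro continuous_on_snd) simp
  then show ?thesis by simp
qed

end

section \<open>Solving the equations and building the subspace\<close>

proposition nearly_unconditional_subspace:
  fixes n k N :: nat and p :: "rvec \<Rightarrow> real" and \<epsilon> :: real
  assumes p: "norm_on (Rn n) p" and k: "0 < k" and \<epsilon>: "0 < \<epsilon>" "\<epsilon> < 1 / 2" "3 / \<epsilon> \<le> N"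
    and n: "card ((Pow {..<k} - {{}}) \<times> lattice_simplex k (k * N)) + k \<le> n"
  obtains E q where "E \<subseteq> Rn n" "subspace E" "dim E = k" "unconditional_norm_on n E q"
    "\<And>x. x \<in> E \<Longrightarrow> (1 - \<epsilon>) * q x \<le> p x \<and> p x \<le> (1 + \<epsilon>) * q x"
proof -
  have N: "0 < N"
  proof -
    have "0 < 3 / \<epsilon>" using \<epsilon> by simp
    then have "0 < real N" using \<epsilon> by linarith
    then show ?thesis by simp
  qed
  \<comment> \<open>One equation for each nontrivial character and each lattice point;
    \<open>h\<close> numbers them.\<close>
  define Eq where "Eq = (Pow {..<k} - {{}}) \<times> lattice_simplex k (k * N)"
  define M where "M = card Eq"
  have "finite Eq" unfolding Eq_def by (simp add: finite_lattice_simplex)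
  then obtain h where h: "bij_betw h {..<M} Eq"
    using ex_bij_betw_nat_finite unfolding M_def atLeast0LessThan by blast
  define X m where "X e = fst (h e)" and "m e = snd (h e)" for e
  \<comment> \<open>Equation \<open>e\<close> is charged to the largest index of its character, and
    coordinate \<open>e\<close> is given to the same block. This is the triangular pattern that
    \<open>cube_common_zero\<close> asks for.\<close>
  define b where "b e = Max (X e)" for e
  have hE: "h e \<in> Eq" if "e < M" for e using h that by (auto simp: bij_betw_def)
  have X: "X e \<subseteq> {..<k}" "X e \<noteq> {}" "finite (X e)" if "e < M" for e
    using hE[OF that] finite_subset[of "X e" "{..<k}"] by (auto simp: X_def Eq_def)
  have bX: "b e \<in> X e" "\<And>j. j \<in> X e \<Longrightarrow> j \<le> b e" if "e < M" for e
    using X[OF that] by (auto simp: b_def)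
  have bk: "b e < k" if "e < M" for e using bX(1)[OF that] X(1)[OF that] by auto
  have dim: "M + k \<le> n" using n by (simp add: M_def Eq_def)
  note ctx = p dim k
  \<comment> \<open>\<open>loz_scale\<close> does not change under boundary flips, so
    \<open>f e\<close> inherits the parity of the Walsh coefficient at \<open>X e\<close>.\<close>
  define f where "f e x = sign_coeff k (X e) (comb_norm p k M b x)
    (\<lambda>i. loz_scale p k M b x i * real (m e i))" for e x
  have cont_S: "continuous_on (cube M) (\<lambda>x. loz_scale p k M b x i)" for i
    by (rule continuous_on_product_then_coordinatewise[OF continuous_on_loz_scale[OF ctx]])
  have cont_f: "continuous_on (cube M) (f e)" for e
    unfolding f_def sign_coeff_def
    by (intro continuous_intros continuous_on_comb_norm[OF ctx] cont_S)
  have odd_f: "f e (flip b (b r) x) = (if b r \<in> X e then - f e x else f e x)"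
    if e: "e < M" and r: "r < M" "\<bar>x r\<bar> = 1" for e x r
  proof -
    have eq: "comb_norm p k M b (flip b (b r) x) = (\<lambda>y. comb_norm p k M b x (\<lambda>i. sg {b r} i * y i))"
      by (rule ext, rule comb_norm_flip[where r = r and x = x and b = b, OF ctx r])
    have "f e (flip b (b r) x) = (if b r \<in> X e then -1 else 1) * f e x"
      unfolding f_def loz_scale_flip[where r = r and x = x and b = b, OF ctx r bk[OF r(1)]] eq
      by (rule sign_coeff_flip[OF bk[OF r(1)] X(3)[OF e]])
    then show ?thesis by simp
  qed
  obtain x where x: "\<And>e. e < M \<Longrightarrow> f e x = 0"
    by (rule cube_common_zero[of M f X b]) (use cont_f odd_f X(3) bX in blast)+
  define s where "s = loz_scale p k M b x"
  let ?q = "sign_avg k (comb_norm p k M b x)"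
  have loz: "lozanovskii k ?q s" unfolding s_def by (rule loz_scale[OF ctx])
  have s: "0 < s i" if "i < k" for i
  proof -
    have "0 < 1 / real k" using k by simp
    moreover have "1 / real k \<le> s i" using loz that by (simp add: lozanovskii_def)
    ultimately show ?thesis by linarith
  qed
  \<comment> \<open>All nontrivial Walsh coefficients vanish at the rescaled lattice points, so
    there the norm does not see signs.\<close>
  have inv: "comb_norm p k M b x (\<lambda>i. sg D i * (s i * real (a i))) = ?q (\<lambda>i. s i * real (a i))"
    if a: "a \<in> lattice_simplex k (k * N)" and D: "D \<subseteq> {..<k}" for a D
  proof (rule sign_coeff_zero_imp_invariant[OF _ D])
    fix Y assume "Y \<subseteq> {..<k}" "Y \<noteq> {}"
    then have "(Y, a) \<in> h ` {..<M}" using a h by (simp add: bij_betw_def Eq_def)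
    then obtain e where "e < M" "h e = (Y, a)" by auto
    then show "sign_coeff k Y (comb_norm p k M b x) (\<lambda>i. s i * real (a i)) = 0"
      using x[of e] by (simp add: f_def X_def m_def s_def)
  qed
  \<comment> \<open>The scaling is absorbed into the vectors: the net becomes integral, and the unit
    ball of \<open>q\<close> lies between the cube and \<open>k\<close> times the
    cross-polytope.\<close>
  define u where "u i = s i *\<^sub>R unit_block p M b x i" for i
  define Q where "Q y = comb_norm p k M b x (\<lambda>i. s i * y i)" for y
  have Q_p: "Q y = p (\<Sum>i<k. y i *\<^sub>R u i)" for y
    by (simp add: Q_def comb_norm_def u_def mult.commute)
  define q where "q y = ?q (\<lambda>i. s i * y i)" for y
  have gq: "uncond_gauge k ?q" by (rule gauge_comb[OF ctx])
  have q_gauge: "uncond_gauge k q"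
    unfolding uncond_gauge_def
  proof (intro conjI allI impI)
    fix y y' :: "nat \<Rightarrow> real" and c :: real
    show "q y = q y'" if "\<forall>i<k. \<bar>y i\<bar> = \<bar>y' i\<bar>"
      unfolding q_def using that by (intro gauge_cong[OF gq]) (simp add: abs_mult)
    show "q (\<lambda>i. c * y i) = \<bar>c\<bar> * q y"
      using gauge_scale[OF gq, of c "\<lambda>i. s i * y i"] by (simp add: q_def mult.left_commute)
    show "q (\<lambda>i. y i + y' i) \<le> q y + q y'"
      using gauge_add[OF gq, of "\<lambda>i. s i * y i" "\<lambda>i. s i * y' i"] by (simp add: q_def distrib_left)
  qed
  have q_low: "(\<Sum>i<k. \<bar>y i\<bar>) \<le> k * q y" for y
  proof -
    have "\<forall>y. (\<Sum>i<k. \<bar>y i\<bar> / s i) \<le> k * ?q y"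
      using loz unfolding lozanovskii_def by (elim conjE)
    then have "(\<Sum>i<k. \<bar>s i * y i\<bar> / s i) \<le> k * q y"
      unfolding q_def by (rule spec)
    also have "(\<Sum>i<k. \<bar>s i * y i\<bar> / s i) = (\<Sum>i<k. \<bar>y i\<bar>)"
    proof (rule sum.cong[OF refl])
      fix i assume "i \<in> {..<k}"
      then have "0 < s i" using s by simp
      then show "\<bar>s i * y i\<bar> / s i = \<bar>y i\<bar>" by (simp add: abs_mult)
    qed
    finally show ?thesis .
  qed
  have q_avg: "Q y \<le> 2 ^ k * q y" for y
    unfolding Q_def q_def
  proof (rule le_sign_avg[where k = k and Q = "comb_norm p k M b x"])
    show "comb_norm p k M b x y = comb_norm p k M b x y'" if "\<And>i. i < k \<Longrightarrow> y i = y' i" for y y'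
      using that by (rule comb_norm_dep[OF ctx])
    show "comb_norm p k M b x (\<lambda>i. c * y i) = \<bar>c\<bar> * comb_norm p k M b x y" for c y
      by (rule comb_norm_hom[OF ctx])
    show "comb_norm p k M b x (\<lambda>i. y i + y' i) \<le> comb_norm p k M b x y + comb_norm p k M b x y'" for y y'
      by (rule comb_norm_sub[OF ctx])
  qed
  have Q_q: "Q y \<le> (1 + \<epsilon>) * q y \<and> (1 - \<epsilon>) * q y \<le> Q y" for y
  proof -
    have dep: "Q y = Q y'" if "\<And>i. i < k \<Longrightarrow> y i = y' i" for y y'
      unfolding Q_def by (rule comb_norm_dep[OF ctx]) (simp add: that)
    have hom: "Q (\<lambda>i. c * y i) = \<bar>c\<bar> * Q y" for c y
      using comb_norm_hom[OF ctx, of b x c "\<lambda>i. s i * y i"] by (simp add: Q_def mult.left_commute)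
    have sub: "Q (\<lambda>i. y i + y' i) \<le> Q y + Q y'" for y y'
      using comb_norm_sub[OF ctx, of b x "\<lambda>i. s i * y i" "\<lambda>i. s i * y' i"] by (simp add: Q_def distrib_left)
    have ones: "q (\<lambda>i. 1) \<le> 1" using loz by (simp add: q_def lozanovskii_def)
    have net: "Q (\<lambda>i. sg D i * real (a i)) = q (\<lambda>i. real (a i))"
      if "a \<in> lattice_simplex k (k * N)" "D \<subseteq> {..<k}" for a D
      using inv[OF that] by (simp add: Q_def q_def mult.left_commute)
    have "Q y \<le> (1 + \<epsilon>) * q y"
      by (rule net_approx(1)[where k = k and N = N and Q = Q and q = q and B = "2 ^ k" and \<epsilon> = \<epsilon>])
         (fact dep hom sub q_gauge ones q_low N net q_avg \<epsilon> | simp)+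
    moreover have "(1 - \<epsilon>) * q y \<le> Q y"
      by (rule net_approx(2)[where k = k and N = N and Q = Q and q = q and B = "2 ^ k" and \<epsilon> = \<epsilon>])
         (fact dep hom sub q_gauge ones q_low N net q_avg \<epsilon> | simp)+
    ultimately show ?thesis ..
  qed
  have q_zero: "y i = 0" if "q y = 0" "i < k" for y i
  proof -
    have "(\<Sum>i<k. \<bar>y i\<bar>) \<le> 0" using q_low[of y] that(1) by simp
    moreover have "\<bar>y i\<bar> \<le> (\<Sum>i<k. \<bar>y i\<bar>)" using that(2) by (intro member_le_sum) auto
    ultimately show ?thesis by simp
  qed
  have u: "u i \<in> Rn n" "u i \<noteq> 0" if "i < k" for i
  proof -
    show "u i \<in> Rn n"
      unfolding u_def by (intro subspace_scale[OF subspace_Rn] unit_block_Rn[OF ctx] that)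
    have "unit_block p M b x i \<noteq> 0"
      using norm_block_pos[OF ctx that, of b x] block_vec_nonzero[of M b x i] by (simp add: unit_block_def)
    then show "u i \<noteq> 0" using s[OF that] by (simp add: u_def)
  qed
  have orth: "inner_Rn n (u i) (u j) = 0" if "i < k" "j < k" "i \<noteq> j" for i j
    using inner_block_vec[OF that(3)] by (simp add: u_def unit_block_def inner_Rn_scaleR)
  have "\<exists>E r. E \<subseteq> Rn n \<and> subspace E \<and> dim E = k \<and> unconditional_norm_on n E r \<and>
      (\<forall>x\<in>E. \<exists>y. x = (\<Sum>i<k. y i *\<^sub>R u i) \<and> r x = q y)"
  proof (rule unconditional_norm_of_gauge[of k u n q])
    fix E r
    assume "E \<subseteq> Rn n" "subspace E" "dim E = k" "unconditional_norm_on n E r"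
      and "\<And>x. x \<in> E \<Longrightarrow> \<exists>y. x = (\<Sum>i<k. y i *\<^sub>R u i) \<and> r x = q y"
    then show ?thesis by (intro exI[of _ E] exI[of _ r] conjI ballI)
  qed (fact u orth q_gauge q_zero)+
  then obtain E r where E: "E \<subseteq> Rn n" "subspace E" "dim E = k" "unconditional_norm_on n E r"
    and rep: "\<forall>x\<in>E. \<exists>y. x = (\<Sum>i<k. y i *\<^sub>R u i) \<and> r x = q y"
    by (elim exE conjE)
  have "(1 - \<epsilon>) * r v \<le> p v \<and> p v \<le> (1 + \<epsilon>) * r v" if v: "v \<in> E" for v
  proof -
    obtain y where "v = (\<Sum>i<k. y i *\<^sub>R u i)" "r v = q y" using bspec[OF rep v] by blast
    then show ?thesis using Q_q[of y] Q_p[of y] by simp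
  qed
  then show ?thesis using that[OF E] by blast
qed

section \<open>Counting the equations\<close>

theorem theorem1p2:
  shows "\<exists>C::real. C > 0 \<and>
    (\<forall>(n::nat) (p::rvec \<Rightarrow> real) (\<epsilon>::real) (k::nat).
       n \<ge> 1 \<longrightarrow> norm_on (Rn n) p \<longrightarrow> 0 < \<epsilon> \<longrightarrow> \<epsilon> < 1/2 \<longrightarrow> k \<ge> 2 \<longrightarrow>
       real n \<ge> (C / \<epsilon>) ^ (3 * (k - 1)) \<longrightarrow>
       (\<exists>(E::rvec set) (q::rvec \<Rightarrow> real).
          E \<subseteq> Rn n \<and> subspace E \<and> dim E = k \<and>
          unconditional_norm_on n E q \<and>
          (\<forall>x\<in>E. (1 - \<epsilon>) * q x \<le> p x \<and> p x \<le> (1 + \<epsilon>) * q x)))"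
proof (intro exI[of _ 48] conjI allI impI)
  fix n :: nat and p :: "rvec \<Rightarrow> real" and \<epsilon> :: real and k :: nat
  assume p: "norm_on (Rn n) p" and \<epsilon>: "0 < \<epsilon>" "\<epsilon> < 1/2" and k: "2 \<le> k"
    and n: "(48 / \<epsilon>) ^ (3 * (k - 1)) \<le> real n"
  \<comment> \<open>\<open>\<epsilon> < 1/2\<close> gives
    \<open>N + 1 \<le> 3 / \<epsilon> + 2 \<le> 4 / \<epsilon>\<close>, so there are at most
    \<open>(2 * 3 * 4 / \<epsilon>) ^ k\<close> equations.\<close>
  define N where "N = nat \<lceil>3 / \<epsilon>\<rceil>"
  have N: "3 / \<epsilon> \<le> real N" "real N \<le> 3 / \<epsilon> + 1"
    using \<epsilon> by (auto simp: N_def of_nat_ceiling)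
  have "2 \<le> 1 / \<epsilon>" using \<epsilon> by (simp add: field_simps)
  then have N4: "real N + 1 \<le> 4 / \<epsilon>" using N by simp
  have "0 < 3 / \<epsilon>" using \<epsilon> by simp
  then have "0 < real N" using N by linarith
  then have N0: "0 < N" by simp
  let ?G = "lattice_simplex k (k * N)"
  have "card ((Pow {..<k} - {{}}) \<times> ?G) \<le> card (Pow {..<k} \<times> ?G)"
    by (rule card_mono) (auto simp: finite_lattice_simplex)
  also have "\<dots> = 2 ^ k * card ?G" by (simp add: card_cartesian_product card_Pow)
  finally have "real (card ((Pow {..<k} - {{}}) \<times> ?G)) \<le> 2 ^ k * real (card ?G)"
    by (metis of_nat_le_iff of_nat_mult of_nat_numeral of_nat_power)
  also have "\<dots> \<le> 2 ^ k * (3 * (real N + 1)) ^ k"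
    by (intro mult_left_mono card_lattice_simplex[OF N0]) auto
  also have "\<dots> \<le> 2 ^ k * (3 * (4 / \<epsilon>)) ^ k"
    using N4 by (intro mult_left_mono power_mono) auto
  also have "\<dots> = (24 / \<epsilon>) ^ k" by (simp flip: power_mult_distrib)
  finally have "real (card ((Pow {..<k} - {{}}) \<times> ?G) + k) \<le> (24 / \<epsilon>) ^ k + real k" by simp
  \<comment> \<open>The \<open>k\<close> extra dimensions are paid for by another factor 2 in the
    base, which turns 24 into 48.\<close>
  also have "\<dots> \<le> (24 / \<epsilon>) ^ k + (24 / \<epsilon>) ^ k"
  proof -
    have "real k \<le> 2 ^ k" using of_nat_less_two_power[of k, where 'a = real] by simp
    also have "\<dots> \<le> (24 / \<epsilon>) ^ k" using \<open>2 \<le> 1 / \<epsilon>\<close> by (intro power_mono) auto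
    finally show ?thesis by simp
  qed
  also have "\<dots> \<le> 2 ^ k * (24 / \<epsilon>) ^ k"
  proof -
    have "(2::real) ^ 1 \<le> 2 ^ k" using k by (intro power_increasing) auto
    then show ?thesis using \<epsilon> mult_right_mono[of 2 "2 ^ k" "(24 / \<epsilon>) ^ k"] by simp
  qed
  also have "\<dots> = (48 / \<epsilon>) ^ k" by (simp flip: power_mult_distrib)
  \<comment> \<open>\<open>k \<ge> 2\<close> gives \<open>k \<le> 3 * (k - 1)\<close>, and the base
    is at least 1.\<close>
  also have "\<dots> \<le> (48 / \<epsilon>) ^ (3 * (k - 1))"
    using k \<epsilon> by (intro power_increasing) auto
  also note n
  finally have "card ((Pow {..<k} - {{}}) \<times> ?G) + k \<le> n" by (simp only: of_nat_le_iff)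
  moreover have "0 < k" using k by simp
  ultimately obtain E q where "E \<subseteq> Rn n" "subspace E" "dim E = k" "unconditional_norm_on n E q"
    "\<And>x. x \<in> E \<Longrightarrow> (1 - \<epsilon>) * q x \<le> p x \<and> p x \<le> (1 + \<epsilon>) * q x"
    using nearly_unconditional_subspace[OF p _ \<epsilon> N(1)] by blast
  then show "\<exists>(E::rvec set) (q::rvec \<Rightarrow> real).
      E \<subseteq> Rn n \<and> subspace E \<and> dim E = k \<and> unconditional_norm_on n E q \<and>
      (\<forall>x\<in>E. (1 - \<epsilon>) * q x \<le> p x \<and> p x \<le> (1 + \<epsilon>) * q x)" by blast
qed simp

end
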